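(* Let $G$ be an unmixed bipartite graph on the vertex set $\{x_1,\ldots,x_n\}\cup\{y_1,\ldots,y_n\}$ with $\{x_i,y_i\}\in E(G)$ for all $i$, let $\mathcal{L}_G$ be its lattice of vertex covers, and let $H_{\mathcal{L}_G}=(u_p : p\in\mathcal{L}_G)\subseteq R=K[x_1,\ldots,x_n,y_1,\ldots,y_n]$. Then there exists a minimal multigraded free resolution $\mathbb{F}$ of the ideal $H_{\mathcal{L}_G}$ such that for each $i\ge 0$ the free module $\mathbb{F}_i$ has a basis consisting of elements $b(p;S)$, where $p\in\mathcal{L}_G$ and $S$ is a subset of the set $N(p)$ of lower neighbors of $p$ with $|S|=i$, and where the multidegree of $b(p;S)$ is (the exponent vector of) the least common multiple of $u_p$ and all $u_q$ with $q\in S$.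
   Context: All graphs are finite and have no isolated vertices. A graph is unmixed if all its minimal vertex covers have the same cardinality. An unmixed bipartite graph has bipartition classes of equal size and a perfect matching, so its vertices can be labelled $x_1,\dots,x_n$ and $y_1,\dots,y_n$ (the two classes) with $\{x_i,y_i\}\in E(G)$ for all $i$; every minimal vertex cover then contains exactly one of $x_i,y_i$ for each $i$. Put $\mathcal{L}_G=\{C\cap\{x_1,\dots,x_n\} : C \text{ is a minimal vertex cover of } G\}$, viewed also as a family of subsets of $[n]$ by identifying $x_i$ with $i$. It is known that $\mathcal{L}_G$ is a sublattice of the Boolean lattice of all subsets, containing $\emptyset$ and the whole set; thus $\wedge$ is intersection and $\vee$ is union. $K$ is a field. For $p\in\mathcal{L}_G$ let $u_p=\prod_{i\in p}x_i\prod_{j\in[n]\setminus p}y_j$. $N(p)$ denotes the set of lower neighbors of $p$ in $\mathcal{L}_G$, i.e. the elements of $\mathcal{L}_G$ covered by $p$. "Multigraded" refers to the $\mathbb{Z}^{2n}$-grading of $R$. *)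

theory Defs
  imports Complex_Main "HOL-Library.Poly_Mapping"
begin

section \<open>Graphs and vertex covers\<close>

definition bipartite_graph :: "'a set \<Rightarrow> 'a set \<Rightarrow> 'a set set \<Rightarrow> bool" where
  "bipartite_graph A B E \<longleftrightarrow>
     finite A \<and> finite B \<and> A \<inter> B = {} \<and> (\<forall>e\<in>E. \<exists>a\<in>A. \<exists>b\<in>B. e = {a, b})"

definition no_isolated_vertices :: "'a set \<Rightarrow> 'a set set \<Rightarrow> bool" where
  "no_isolated_vertices V E \<longleftrightarrow> (\<forall>v\<in>V. \<exists>e\<in>E. v \<in> e)"

definition vertex_cover :: "'a set \<Rightarrow> 'a set set \<Rightarrow> 'a set \<Rightarrow> bool" where
  "vertex_cover V E C \<longleftrightarrow> C \<subseteq> V \<and> (\<forall>e\<in>E. e \<inter> C \<noteq> {})"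

definition minimal_vertex_cover :: "'a set \<Rightarrow> 'a set set \<Rightarrow> 'a set \<Rightarrow> bool" where
  "minimal_vertex_cover V E C \<longleftrightarrow>
     vertex_cover V E C \<and> (\<forall>D. D \<subset> C \<longrightarrow> \<not> vertex_cover V E D)"

definition unmixed :: "'a set \<Rightarrow> 'a set set \<Rightarrow> bool" where
  "unmixed V E \<longleftrightarrow>
     (\<forall>C D. minimal_vertex_cover V E C \<longrightarrow> minimal_vertex_cover V E D \<longrightarrow> card C = card D)"

text \<open>
  The index set \<open>{1, \<dots>, n}\<close> is rendered by a finite type \<open>'n\<close>. The vertices, which are also
  the variables of the polynomial ring, form the type \<open>'n + 'n\<close>, with \<open>Inl i\<close> for
  \<open>x\<^sub>i\<close> and \<open>Inr i\<close> for \<open>y\<^sub>i\<close>.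
\<close>

definition cover_lattice :: "('n + 'n) set set \<Rightarrow> 'n set set" where
  "cover_lattice E = {Inl -` C | C. minimal_vertex_cover UNIV E C}"

definition lower_neighbors :: "'a set set \<Rightarrow> 'a set \<Rightarrow> 'a set set" where
  "lower_neighbors L p = {q \<in> L. q \<subset> p \<and> \<not> (\<exists>r\<in>L. q \<subset> r \<and> r \<subset> p)}"


section \<open>The multigraded polynomial ring\<close>

text \<open>Polynomials over \<open>'k\<close> in the variables \<open>'v\<close>, as finitely supported functions on exponent
  vectors; multiplication is the convolution product.\<close>

type_synonym ('v, 'k) mpoly = "('v \<Rightarrow>\<^sub>0 nat) \<Rightarrow>\<^sub>0 'k"

definition monom :: "('v \<Rightarrow>\<^sub>0 nat) \<Rightarrow> ('v, 'k::field) mpoly" where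
  "monom m = Poly_Mapping.single m 1"

definition var :: "'v \<Rightarrow> ('v, 'k::field) mpoly" where
  "var v = monom (Poly_Mapping.single v 1)"

text \<open>An exponent vector as an element of the grading group, the free abelian group on \<open>'v\<close>.\<close>

definition multidegree :: "('v \<Rightarrow>\<^sub>0 nat) \<Rightarrow> ('v \<Rightarrow>\<^sub>0 int)" where
  "multidegree m = Poly_Mapping.map int m"

definition ring_comp :: "('v \<Rightarrow>\<^sub>0 int) \<Rightarrow> ('v, 'k::field) mpoly set" where
  "ring_comp a = {f. \<forall>m\<in>Poly_Mapping.keys f. multidegree m = a}"

definition generated_ideal :: "'r::comm_ring_1 set \<Rightarrow> 'r set" where
  "generated_ideal A = module.span (*) A"

definition is_lcm :: "'r::comm_ring_1 set \<Rightarrow> 'r \<Rightarrow> bool" where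
  "is_lcm A f \<longleftrightarrow> (\<forall>g\<in>A. g dvd f) \<and> (\<forall>h. (\<forall>g\<in>A. g dvd h) \<longrightarrow> f dvd h)"

definition u :: "'n::finite set \<Rightarrow> ('n + 'n, 'k::field) mpoly" where
  "u p = (\<Prod>i\<in>p. var (Inl i)) * (\<Prod>j\<in>- p. var (Inr j))"

definition H :: "('n::finite + 'n) set set \<Rightarrow> ('n + 'n, 'k::field) mpoly set" where
  "H E = generated_ideal (u ` cover_lattice E)"


section \<open>Multigraded modules and resolutions\<close>

text \<open>Modules are submodules \<open>M\<close> of an ambient module over the type \<open>'m\<close>; \<open>comp a\<close> is the
  homogeneous component of \<open>M\<close> of degree \<open>a\<close>.\<close>

locale multigraded_module = module scale
  for scale :: "('v, 'k::field) mpoly \<Rightarrow> 'm::ab_group_add \<Rightarrow> 'm" +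
  fixes M :: "'m set" and comp :: "('v \<Rightarrow>\<^sub>0 int) \<Rightarrow> 'm set"
  assumes submodule: "subspace M"
    and comp_subset: "comp a \<subseteq> M"
    and comp_zero: "0 \<in> comp a"
    and comp_diff: "x \<in> comp a \<Longrightarrow> y \<in> comp a \<Longrightarrow> x - y \<in> comp a"
    and comp_scale: "r \<in> ring_comp a \<Longrightarrow> x \<in> comp b \<Longrightarrow> scale r x \<in> comp (a + b)"
    and direct_sum: "x \<in> M \<Longrightarrow>
      \<exists>!c :: ('v \<Rightarrow>\<^sub>0 int) \<Rightarrow>\<^sub>0 'm. (\<forall>a. Poly_Mapping.lookup c a \<in> comp a) \<and>
        x = (\<Sum>a\<in>Poly_Mapping.keys c. Poly_Mapping.lookup c a)"

text \<open>The family \<open>b\<close>, indexed by \<open>I\<close>, is a basis of the submodule \<open>M\<close>.\<close>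

definition family_basis ::
    "('r::comm_ring_1 \<Rightarrow> 'm::ab_group_add \<Rightarrow> 'm) \<Rightarrow> 'm set \<Rightarrow> 'i set \<Rightarrow> ('i \<Rightarrow> 'm) \<Rightarrow> bool" where
  "family_basis scale M I b \<longleftrightarrow>
     inj_on b I \<and> \<not> module.dependent scale (b ` I) \<and> module.span scale (b ` I) = M"

definition linear_map_on ::
    "('r::comm_ring_1 \<Rightarrow> 'm::ab_group_add \<Rightarrow> 'm) \<Rightarrow> ('r \<Rightarrow> 'l::ab_group_add \<Rightarrow> 'l) \<Rightarrow>
     'm set \<Rightarrow> ('m \<Rightarrow> 'l) \<Rightarrow> bool" where
  "linear_map_on scale scale' M f \<longleftrightarrow>
     (\<forall>x\<in>M. \<forall>y\<in>M. f (x + y) = f x + f y) \<and> (\<forall>r. \<forall>x\<in>M. f (scale r x) = scale' r (f x))"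

text \<open>An exact complex
  \<open>\<dots> \<rightarrow> F 2 \<rightarrow> F 1 \<rightarrow> F 0 \<rightarrow> J \<rightarrow> 0\<close> of multigraded modules with maps \<open>d i\<close> from \<open>F (i + 1)\<close> to
  \<open>F i\<close> and augmentation \<open>eps\<close>, all of degree \<open>0\<close>. Each \<open>F i\<close> has a homogeneous basis, and the
  image of \<open>d i\<close> lies in \<open>F i\<close> multiplied by the ideal generated by the variables.\<close>

locale minimal_multigraded_free_resolution = module scale
  for scale :: "('v, 'k::field) mpoly \<Rightarrow> 'm::ab_group_add \<Rightarrow> 'm" +
  fixes F :: "nat \<Rightarrow> 'm set"
    and comp :: "nat \<Rightarrow> ('v \<Rightarrow>\<^sub>0 int) \<Rightarrow> 'm set"
    and d :: "nat \<Rightarrow> 'm \<Rightarrow> 'm"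
    and eps :: "'m \<Rightarrow> ('v, 'k) mpoly"
    and J :: "('v, 'k) mpoly set"
  assumes graded: "multigraded_module scale (F i) (comp i)"
    and free: "\<exists>B \<subseteq> (\<Union>a. comp i a). family_basis scale (F i) B (\<lambda>x. x)"
    and d_linear: "linear_map_on scale scale (F (Suc i)) (d i)"
    and d_degree: "d i ` comp (Suc i) a \<subseteq> comp i a"
    and eps_linear: "linear_map_on scale (*) (F 0) eps"
    and eps_degree: "eps ` comp 0 a \<subseteq> ring_comp a"
    and eps_onto: "eps ` F 0 = J"
    and exact_0: "d 0 ` F 1 = {x \<in> F 0. eps x = 0}"
    and exact_Suc: "d (Suc i) ` F (Suc (Suc i)) = {x \<in> F (Suc i). d i x = 0}"
    and minimal: "d i ` F (Suc i) \<subseteq>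
      span {scale r x | r x. r \<in> generated_ideal (range var) \<and> x \<in> F i}"

end

theory Submission
  imports Defs "HOL-Library.Countable"
begin

text \<open>
  Lower neighbours of \<open>p\<close> arise by removing pairwise disjoint blocks \<open>A\<close>, so that \<open>S \<subseteq> N(p)\<close>
  amounts to a set \<open>T\<close> of blocks and \<open>b(p; S)\<close> to the Boolean interval \<open>[p - \<Union>T, p]\<close> of the
  lattice. The differential is that of a cubical complex,
  \<open>(p, T) \<mapsto> \<Sum>A\<in>T. \<plusminus> (y\<^sub>A (p, T - {A}) - x\<^sub>A (p - A, T - {A}))\<close>.
  Cells inside an interval \<open>[a, b]\<close> of the lattice form an acyclic complex, by induction on \<open>b - a\<close>:
  removing a block \<open>A\<close> from \<open>b\<close>, the cells with \<open>A \<in> T\<close> form a cylinder that pushes multiples of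
  \<open>y\<^sub>A\<close> from the cells above \<open>A\<close> down to the cells below \<open>b - A\<close>. What remains above \<open>A\<close> has no
  coefficient divisible by \<open>y\<^sub>A\<close>, so it decouples from the rest, and both parts are
  handled by induction.
\<close>

section \<open>Multiplication by monomials\<close>

text \<open>Acyclicity is proved over the whole ring at once, with division by the monomial y_A in
  the place of an argument degree by degree: every coefficient is a multiple of y_A plus a remainder
  none of whose monomials is divisible by y_A. On cells lying above A, the directions B are disjoint
  from A, so the coefficients x_B and y_B of the differential turn remainders into remainders; there
  u_p has no y_i with i in A, so the augmentation does the same. Below b - A, on the other hand,
  every u_p is a multiple of y_A. This is why a relation between the two parts falls apart in the
  complex and in the ideal alike. Intervals enter because the two parts are not complexes of the
  full lattice: the cells above A form an interval again only after a is replaced by the least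
  lattice element containing a and A. Chains of all dimensions are treated together, with the
  augmentation extended by zero, so that a single statement covers exactness everywhere.\<close>

abbreviation lk :: "('a \<Rightarrow>\<^sub>0 'b::zero) \<Rightarrow> 'a \<Rightarrow> 'b" where
  "lk \<equiv> Poly_Mapping.lookup"

lemma poly_mapping_add_factor_iff:
  fixes m k :: "'v \<Rightarrow>\<^sub>0 nat"
  shows "(\<exists>l. k = m + l) \<longleftrightarrow> (\<forall>v. lk m v \<le> lk k v)"
proof
  assume "\<forall>v. lk m v \<le> lk k v"
  then have "k = m + (k - m)"
    by (intro poly_mapping_eqI) (simp add: lookup_add lookup_minus)
  then show "\<exists>l. k = m + l" ..
qed (auto simp: lookup_add)

lemma monom_add: "monom (m + m') = monom m * monom m'"
  by (simp add: monom_def mult_single)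

text \<open>Adding \<open>m\<close> is injective on exponents, so multiplication by
  \<open>monom m\<close> moves coefficients without merging any. The induction adds one term of
  \<open>f\<close> at a time.\<close>

lemma lookup_monom_times: "lk (monom m * f) (m + k) = lk f k"
proof (induction f rule: update_induct)
  case const
  then show ?case by simp
next
  case (update f a b)
  have eq: "Poly_Mapping.update a b f = f + Poly_Mapping.single a b"
    using update(1) by (intro poly_mapping_eqI)
      (auto simp: lookup_update lookup_add lookup_single when_def not_in_keys_iff_lookup_eq_zero)
  have "lk (monom m * Poly_Mapping.single a b) (m + k) = lk (Poly_Mapping.single a b) k"
    by (simp add: monom_def mult_single lookup_single)
  then show ?case
    using update by (simp add: eq distrib_left lookup_add)
qed

lemma keys_monom_times: "Poly_Mapping.keys (monom m * f) = (+) m ` Poly_Mapping.keys f"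
proof
  show "Poly_Mapping.keys (monom m * f) \<subseteq> (+) m ` Poly_Mapping.keys f"
    using keys_mult[of "monom m" f] by (auto simp: monom_def)
  show "(+) m ` Poly_Mapping.keys f \<subseteq> Poly_Mapping.keys (monom m * f)"
    by (auto simp: in_keys_iff lookup_monom_times)
qed

lemma monom_dvd_iff:
  "monom m dvd f \<longleftrightarrow> (\<forall>k\<in>Poly_Mapping.keys f. \<forall>v. lk m v \<le> lk k v)"
proof
  assume "monom m dvd f"
  then show "\<forall>k\<in>Poly_Mapping.keys f. \<forall>v. lk m v \<le> lk k v"
    by (auto simp: dvd_def keys_monom_times lookup_add)
next
  assume *: "\<forall>k\<in>Poly_Mapping.keys f. \<forall>v. lk m v \<le> lk k v"
  \<comment> \<open>\<open>map_key ((+) m)\<close> reads off the coefficients at the exponents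
    \<open>m + k\<close>. It is the quotient by \<open>monom m\<close>; by \<open>*\<close> no
    monomial of \<open>f\<close> is lost.\<close>
  have "f = monom m * Poly_Mapping.map_key ((+) m) f" (is "f = ?g")
  proof (rule poly_mapping_eqI)
    fix k
    show "lk f k = lk ?g k"
    proof (cases "\<exists>l. k = m + l")
      case True
      then show ?thesis by (auto simp: lookup_monom_times map_key.rep_eq)
    next
      case False
      then have "k \<notin> Poly_Mapping.keys f" "k \<notin> Poly_Mapping.keys ?g"
        using * by (auto simp: keys_monom_times simp flip: poly_mapping_add_factor_iff)
      then show ?thesis by (simp add: in_keys_iff)
    qed
  qed
  then show "monom m dvd f" by (rule dvdI)
qed

text \<open>The possible remainders of division by \<open>monom m\<close>: no monomial of
  \<open>f\<close> is a multiple of \<open>m\<close>. They form a vector space complement of the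
  ideal generated by \<open>monom m\<close>.\<close>

definition avoids :: "('v \<Rightarrow>\<^sub>0 nat) \<Rightarrow> ('v, 'k::field) mpoly \<Rightarrow> bool" where
  "avoids m f \<longleftrightarrow> (\<forall>k. lk f (m + k) = 0)"

lemma avoids_0 [simp]: "avoids m 0"
  by (simp add: avoids_def)

lemma avoids_add: "avoids m f \<Longrightarrow> avoids m g \<Longrightarrow> avoids m (f + g)"
  by (simp add: avoids_def lookup_add)

lemma avoids_uminus: "avoids m f \<Longrightarrow> avoids m (- f)"
  by (simp add: avoids_def)

lemma avoids_diff: "avoids m f \<Longrightarrow> avoids m g \<Longrightarrow> avoids m (f - g)"
  by (simp add: avoids_def lookup_minus)

lemma avoids_sum: "(\<And>i. i \<in> I \<Longrightarrow> avoids m (f i)) \<Longrightarrow> avoids m (sum f I)"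
  by (induction I rule: infinite_finite_induct) (auto intro: avoids_add)

lemma monom_times_decomp:
  obtains g h where "f = monom m * g + h" "avoids m h"
proof
  define g where "g = Poly_Mapping.map_key ((+) m) f"
  show "f = monom m * g + (f - monom m * g)" by simp
  show "avoids m (f - monom m * g)"
    by (simp add: avoids_def lookup_minus lookup_monom_times g_def map_key.rep_eq)
qed

text \<open>Uniqueness of quotient and remainder: the coefficient at \<open>m + k\<close> sees only
  \<open>g\<close>.\<close>

lemma monom_times_add_eq_0:
  assumes "monom m * g + h = 0" "avoids m h"
  shows "g = 0" "h = 0"
proof -
  show "g = 0"
  proof (rule poly_mapping_eqI)
    fix k
    have "lk (monom m * g + h) (m + k) = 0" using assms(1) by simp
    then show "lk g k = lk 0 k"
      using assms(2) by (simp add: lookup_add lookup_monom_times avoids_def)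
  qed
  then show "h = 0" using assms(1) by simp
qed

text \<open>The second hypothesis says that \<open>m\<close> and \<open>m'\<close> have no common
  variable; then \<open>m\<close> divides \<open>m' + l\<close> only if it divides
  \<open>l\<close>.\<close>

lemma avoids_monom_times:
  assumes "avoids m f" "\<And>v. lk m v = 0 \<or> lk m' v = 0"
  shows "avoids m (monom m' * f)"
  unfolding avoids_def
proof
  fix k
  show "lk (monom m' * f) (m + k) = 0"
  proof (rule ccontr)
    assume "lk (monom m' * f) (m + k) \<noteq> 0"
    then obtain l where l: "m + k = m' + l" "lk f l \<noteq> 0"
      by (auto simp: keys_monom_times simp flip: in_keys_iff)
    have "lk m v \<le> lk l v" for v
      using assms(2)[of v] arg_cong[OF l(1), of "\<lambda>x. lk x v"] by (auto simp: lookup_add)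
    then obtain l' where "l = m + l'"
      using poly_mapping_add_factor_iff by blast
    then show False using l(2) assms(1) by (simp add: avoids_def)
  qed
qed

section \<open>The free module on a finite type\<close>

definition fscale :: "'r::comm_ring_1 \<Rightarrow> ('i \<Rightarrow>\<^sub>0 'r) \<Rightarrow> ('i \<Rightarrow>\<^sub>0 'r)" where
  "fscale r z = Poly_Mapping.map ((*) r) z"

lemma lookup_fscale [simp]: "lk (fscale r z) k = r * lk z k"
  by (simp add: fscale_def Poly_Mapping.map.rep_eq when_def)

interpretation fmod: module "fscale :: 'r::comm_ring_1 \<Rightarrow> ('i \<Rightarrow>\<^sub>0 'r) \<Rightarrow> _"
  by standard (auto intro!: poly_mapping_eqI simp: lookup_add algebra_simps)

abbreviation unit_vec :: "'i \<Rightarrow> ('i \<Rightarrow>\<^sub>0 'r::comm_ring_1)" where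
  "unit_vec k \<equiv> Poly_Mapping.single k 1"

text \<open>Linear extension of values prescribed on the basis. The index type is finite, so the sum
  may run over \<open>UNIV\<close>.\<close>

definition lift :: "('i::finite \<Rightarrow> ('j \<Rightarrow>\<^sub>0 'r::comm_ring_1)) \<Rightarrow> ('i \<Rightarrow>\<^sub>0 'r) \<Rightarrow> ('j \<Rightarrow>\<^sub>0 'r)" where
  "lift f z = (\<Sum>k\<in>UNIV. fscale (lk z k) (f k))"

lemma lift_add: "lift f (x + y) = lift f x + lift f y"
  by (simp add: lift_def lookup_add fmod.scale_left_distrib sum.distrib)

lemma lift_scale: "lift f (fscale r x) = fscale r (lift f x)"
  by (simp add: lift_def fmod.scale_sum_right)

lemma lift_diff: "lift f (x - y) = lift f x - lift f y"
  by (simp add: lift_def lookup_minus fmod.scale_left_diff_distrib sum_subtractf)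

lemma lift_0 [simp]: "lift f 0 = 0"
  by (simp add: lift_def)

lemma lift_sum: "lift f (sum g I) = (\<Sum>i\<in>I. lift f (g i))"
  by (induction I rule: infinite_finite_induct) (simp_all add: lift_add)

lemma lift_unit_vec [simp]: "lift f (unit_vec k) = f k"
proof -
  have "lift f (unit_vec k) = (\<Sum>i\<in>UNIV. if i = k then f k else 0)"
    unfolding lift_def by (intro sum.cong) (auto simp: lookup_single when_def)
  then show ?thesis by simp
qed

lemma lookup_lift: "lk (lift f z) j = (\<Sum>k\<in>UNIV. lk z k * lk (f k) j)"
  by (simp add: lift_def lookup_sum)

lemma lift_unit_vec_eq: "lift unit_vec z = z"
proof (rule poly_mapping_eqI)
  fix k
  have "lk (lift unit_vec z) k = (\<Sum>i\<in>UNIV. if i = k then lk z k else 0)"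
    unfolding lookup_lift by (intro sum.cong) (auto simp: lookup_single when_def)
  then show "lk (lift unit_vec z) k = lk z k" by simp
qed

lemma lift_lift: "lift g (lift f z) = lift (\<lambda>k. lift g (f k)) z"
  unfolding lift_def[of f] by (simp add: lift_sum lift_scale lift_def[of "\<lambda>k. lift g (f k)"])

text \<open>The free submodule on the basis vectors indexed by \<open>K\<close>. All terms of the
  resolution are of this form, inside one ambient module on all pairs \<open>(p, T)\<close>.\<close>

definition supported :: "'i set \<Rightarrow> ('i \<Rightarrow>\<^sub>0 'r::zero) set" where
  "supported K = {z. Poly_Mapping.keys z \<subseteq> K}"

lemma supported_iff: "z \<in> supported K \<longleftrightarrow> (\<forall>k. k \<notin> K \<longrightarrow> lk z k = 0)"
  by (auto simp: supported_def in_keys_iff)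

lemma subspace_supported: "fmod.subspace (supported K)"
  by (rule fmod.subspaceI) (auto simp: supported_iff lookup_add)

lemma supported_mono: "z \<in> supported K \<Longrightarrow> K \<subseteq> K' \<Longrightarrow> z \<in> supported K'"
  by (auto simp: supported_def)

lemma unit_vec_supported [simp]: "(unit_vec k :: 'i \<Rightarrow>\<^sub>0 'r::comm_ring_1) \<in> supported K \<longleftrightarrow> k \<in> K"
  by (simp add: supported_def)

lemma lift_cong:
  assumes "z \<in> supported K" "\<And>k. k \<in> K \<Longrightarrow> f k = g k"
  shows "lift f z = lift g z"
  unfolding lift_def
proof (intro sum.cong refl)
  fix k
  show "fscale (lk z k) (f k) = fscale (lk z k) (g k)"
    using assms by (cases "k \<in> K") (auto simp: supported_iff)
qed

lemma lift_in_subspace: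
  assumes "fmod.subspace S" "z \<in> supported K" "\<And>k. k \<in> K \<Longrightarrow> f k \<in> S"
  shows "lift f z \<in> S"
  unfolding lift_def
proof (rule fmod.subspace_sum[OF assms(1)])
  fix k
  show "fscale (lk z k) (f k) \<in> S"
    using assms fmod.subspace_0[OF assms(1)]
    by (cases "k \<in> K") (auto intro: fmod.subspace_scale simp: supported_iff)
qed

definition restr :: "'i::finite set \<Rightarrow> ('i \<Rightarrow>\<^sub>0 'r::comm_ring_1) \<Rightarrow> ('i \<Rightarrow>\<^sub>0 'r)" where
  "restr K = lift (\<lambda>k. if k \<in> K then unit_vec k else 0)"

lemma lookup_restr: "lk (restr K z) k = (if k \<in> K then lk z k else 0)"
proof -
  have "lk (restr K z) k = (\<Sum>i\<in>UNIV. if i = k then (if k \<in> K then lk z k else 0) else 0)"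
    unfolding lookup_lift restr_def by (intro sum.cong) (auto simp: lookup_single when_def)
  then show ?thesis by simp
qed

lemma restr_supported: "restr K z \<in> supported K"
  by (simp add: supported_iff lookup_restr)

lemma restr_split: "z = restr K z + restr (- K) z"
  by (rule poly_mapping_eqI) (simp add: lookup_add lookup_restr)

lemma restr_supported_Int: "z \<in> supported K \<Longrightarrow> restr K' z \<in> supported (K \<inter> K')"
  by (auto simp: supported_iff lookup_restr)

lemma supported_disjoint_sum_eq_0:
  assumes "x + y = 0" "x \<in> supported K" "y \<in> supported K'" "K \<inter> K' = {}"
  shows "x = 0" "y = 0"
proof -
  have "lk x k = 0" for k
  proof (cases "k \<in> K")
    case True
    then have "lk y k = 0" using assms(3,4) by (auto simp: supported_iff)
    then show ?thesis using arg_cong[OF assms(1), of "\<lambda>z. lk z k"] by (simp add: lookup_add)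
  next
    case False
    then show ?thesis using assms(2) by (simp add: supported_iff)
  qed
  then show "x = 0" by (intro poly_mapping_eqI) simp
  then show "y = 0" using assms(1) by simp
qed

section \<open>Lattices of sets\<close>

locale set_lattice =
  fixes L :: "'n::finite set set"
  assumes Un_closed: "p \<in> L \<Longrightarrow> q \<in> L \<Longrightarrow> p \<union> q \<in> L"
    and Int_closed: "p \<in> L \<Longrightarrow> q \<in> L \<Longrightarrow> p \<inter> q \<in> L"
begin

text \<open>Differences are recorded instead of the lower neighbours themselves because they survive
  a move to a smaller lattice element (\<open>blocks_Diff\<close>, \<open>blocks_below\<close>), so
  a face of a cell keeps its remaining directions.\<close>

definition blocks :: "'n set \<Rightarrow> 'n set set" where
  "blocks p = (\<lambda>q. p - q) ` lower_neighbors L p"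

lemma blocks_iff:
  "A \<in> blocks p \<longleftrightarrow> A \<subseteq> p \<and> A \<noteq> {} \<and> p - A \<in> L \<and> (\<forall>r\<in>L. p - A \<subseteq> r \<longrightarrow> r \<subseteq> p \<longrightarrow> r = p - A \<or> r = p)"
    (is "_ \<longleftrightarrow> ?P")
proof
  assume "A \<in> blocks p"
  then obtain q where "q \<in> lower_neighbors L p" "A = p - q" by (auto simp: blocks_def)
  moreover from this have "p - A = q" by (auto simp: lower_neighbors_def)
  ultimately show ?P by (auto simp: lower_neighbors_def)
next
  assume P: ?P
  then have "p - A \<in> lower_neighbors L p" by (auto simp: lower_neighbors_def)
  moreover have "p - (p - A) = A" using P by auto
  ultimately show "A \<in> blocks p" unfolding blocks_def by (metis imageI)
qed

lemma blocksD: "A \<in> blocks p \<Longrightarrow> A \<subseteq> p" "A \<in> blocks p \<Longrightarrow> A \<noteq> {}" "A \<in> blocks p \<Longrightarrow> p - A \<in> L"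
  by (auto simp: blocks_iff)

lemma blocks_cover:
  "A \<in> blocks p \<Longrightarrow> r \<in> L \<Longrightarrow> p - A \<subseteq> r \<Longrightarrow> r \<subseteq> p \<Longrightarrow> r = p - A \<or> r = p"
  unfolding blocks_iff by blast

text \<open>If \<open>A\<close> and \<open>B\<close> met, the join of the lower neighbours
  \<open>p - A\<close> and \<open>p - B\<close> would be smaller than \<open>p\<close>, hence equal
  to both of them.\<close>

lemma blocks_disjoint:
  assumes "A \<in> blocks p" "B \<in> blocks p" "A \<noteq> B"
  shows "A \<inter> B = {}"
proof (rule ccontr)
  assume "A \<inter> B \<noteq> {}"
  have mem: "(p - A) \<union> (p - B) \<in> L" using assms by (intro Un_closed blocksD)
  have sub: "A \<subseteq> p" "B \<subseteq> p" using assms blocksD by auto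
  then have ne: "(p - A) \<union> (p - B) \<noteq> p" using \<open>A \<inter> B \<noteq> {}\<close> by auto
  have "(p - A) \<union> (p - B) = p - A"
    using blocks_cover[OF assms(1) mem] ne by auto
  moreover have "(p - A) \<union> (p - B) = p - B"
    using blocks_cover[OF assms(2) mem] ne by auto
  ultimately have "p - A = p - B" by simp
  then show False using sub assms(3) by blast
qed

text \<open>For nonempty \<open>T\<close> this is an intersection of lower neighbours of
  \<open>p\<close>; it is the bottom of the Boolean interval belonging to
  \<open>(p, T)\<close>.\<close>

lemma Diff_blocks_closed:
  assumes "p \<in> L" "T \<subseteq> blocks p"
  shows "p - \<Union>T \<in> L"
  using finite[of T] assms(2)
proof (induction T rule: finite_induct)
  case empty
  then show ?case using assms(1) by simp
next
  case (insert A T)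
  have "p - \<Union>(insert A T) = (p - \<Union>T) \<inter> (p - A)" by auto
  then show ?case using insert blocksD(3)[of A p] by (auto intro: Int_closed)
qed

text \<open>Joining with \<open>p - B\<close> carries the interval from \<open>p - A - B\<close> to
  \<open>p - A\<close> into the one from \<open>p - B\<close> to \<open>p\<close>, which has nothing
  strictly between its ends.\<close>

lemma blocks_Diff:
  assumes "A \<in> blocks p" "B \<in> blocks p" "A \<noteq> B"
  shows "B \<in> blocks (p - A)"
proof -
  have disj: "A \<inter> B = {}" using assms by (rule blocks_disjoint)
  have sub: "A \<subseteq> p" "B \<subseteq> p" "B \<noteq> {}" "p - A \<in> L" "p - B \<in> L"
    using assms blocksD by auto
  have "p - A - B = (p - A) \<inter> (p - B)" by auto
  then have "p - A - B \<in> L" using sub Int_closed by simp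
  moreover have "r = p - A - B \<or> r = p - A" if r: "r \<in> L" "p - A - B \<subseteq> r" "r \<subseteq> p - A" for r
  proof -
    have "r \<union> (p - B) \<in> L" using r sub Un_closed by simp
    then have "r \<union> (p - B) = p - B \<or> r \<union> (p - B) = p"
      using r by (intro blocks_cover[OF assms(2)]) auto
    then show ?thesis using r sub by auto
  qed
  ultimately show ?thesis using disj sub by (auto simp: blocks_iff)
qed

text \<open>The join of \<open>p\<close> with \<open>b - A\<close> can only be \<open>b - A\<close>
  or \<open>b\<close>. In the first case \<open>p\<close> misses \<open>A\<close>; in the second it
  contains \<open>A\<close>, and the same join shows that \<open>p - A\<close> is covered by
  \<open>p\<close>.\<close>

lemma blocks_below:
  assumes "A \<in> blocks b" "p \<in> L" "p \<subseteq> b"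
  shows "A \<inter> p = {} \<or> A \<in> blocks p"
proof -
  have A: "A \<subseteq> b" "A \<noteq> {}" "b - A \<in> L" using assms blocksD by auto
  have "p \<union> (b - A) \<in> L" using A assms Un_closed by simp
  then have "p \<union> (b - A) = b - A \<or> p \<union> (b - A) = b"
    using assms by (intro blocks_cover[OF assms(1)]) auto
  then show ?thesis
  proof
    assume "p \<union> (b - A) = b"
    then have Ap: "A \<subseteq> p" using A by auto
    have "p - A = p \<inter> (b - A)" using assms by auto
    then have "p - A \<in> L" using A assms Int_closed by simp
    moreover have "r = p - A \<or> r = p" if r: "r \<in> L" "p - A \<subseteq> r" "r \<subseteq> p" for r
    proof -
      have "r \<union> (b - A) \<in> L" using A r Un_closed by simp
      then have "r \<union> (b - A) = b - A \<or> r \<union> (b - A) = b"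
        using assms r by (intro blocks_cover[OF assms(1)]) auto
      then show ?thesis using r A by auto
    qed
    ultimately show ?thesis using Ap A by (auto simp: blocks_iff)
  qed auto
qed

lemma exists_block:
  assumes "a \<in> L" "b \<in> L" "a \<subset> b"
  obtains A where "A \<in> blocks b" "a \<subseteq> b - A"
proof -
  define S where "S = {c\<in>L. a \<subseteq> c \<and> c \<subset> b}"
  have "\<exists>c\<in>S. \<forall>r\<in>S. c \<subseteq> r \<longrightarrow> c = r"
    using assms by (intro finite_has_maximal) (auto simp: S_def)
  then obtain c where "c \<in> S" "\<And>r. r \<in> S \<Longrightarrow> c \<subseteq> r \<Longrightarrow> c = r"
    by blast
  then have c: "c \<in> L" "a \<subseteq> c" "c \<subset> b" "\<And>r. r \<in> L \<Longrightarrow> a \<subseteq> r \<Longrightarrow> r \<subset> b \<Longrightarrow> c \<subseteq> r \<Longrightarrow> c = r"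
    by (auto simp: S_def)
  have "b - (b - c) = c" using c(3) by auto
  moreover have "r = c \<or> r = b" if "r \<in> L" "c \<subseteq> r" "r \<subseteq> b" for r
    using c(4)[OF that(1)] that c(2) by blast
  ultimately have "b - c \<in> blocks b"
    using c(1,3) by (auto simp: blocks_iff)
  moreover have "a \<subseteq> b - (b - c)" using c(2,3) by auto
  ultimately show thesis by (rule that)
qed

text \<open>A minimal choice is least because the lattice is closed under intersection. It supplies
  the lower end of the interval formed by the cells above a block.\<close>

lemma exists_least_above:
  assumes "b \<in> L" "s \<subseteq> b"
  obtains a where "a \<in> L" "s \<subseteq> a" "a \<subseteq> b" "\<And>p. p \<in> L \<Longrightarrow> s \<subseteq> p \<Longrightarrow> a \<subseteq> p"
proof -
  have "\<exists>a\<in>{p\<in>L. s \<subseteq> p}. \<forall>r\<in>{p\<in>L. s \<subseteq> p}. r \<subseteq> a \<longrightarrow> a = r"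
    using assms by (intro finite_has_minimal) auto
  then obtain a where a: "a \<in> L" "s \<subseteq> a" "\<And>r. r \<in> L \<Longrightarrow> s \<subseteq> r \<Longrightarrow> r \<subseteq> a \<Longrightarrow> a = r"
    by auto
  have le: "a \<subseteq> p" if "p \<in> L" "s \<subseteq> p" for p
    using a(3)[of "a \<inter> p"] a that Int_closed[of a p] by auto
  show thesis using a(1,2) le assms by (intro that[of a]) auto
qed

definition cells :: "'n set \<Rightarrow> 'n set \<Rightarrow> ('n set \<times> 'n set set) set" where
  "cells a b = {(p, T). p \<in> L \<and> T \<subseteq> blocks p \<and> a \<subseteq> p - \<Union>T \<and> p \<subseteq> b}"

end

section \<open>The cubical differential\<close>

definition exp_x :: "'n::finite set \<Rightarrow> ('n + 'n \<Rightarrow>\<^sub>0 nat)" where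
  "exp_x A = (\<Sum>i\<in>A. Poly_Mapping.single (Inl i) 1)"

definition exp_y :: "'n::finite set \<Rightarrow> ('n + 'n \<Rightarrow>\<^sub>0 nat)" where
  "exp_y A = (\<Sum>i\<in>A. Poly_Mapping.single (Inr i) 1)"

lemma lookup_exp_x:
  "lk (exp_x A) (Inl i) = (if i \<in> A then 1 else 0)" "lk (exp_x A) (Inr i) = 0"
  by (simp_all add: exp_x_def lookup_sum lookup_single when_def)

lemma lookup_exp_y:
  "lk (exp_y A) (Inr i) = (if i \<in> A then 1 else 0)" "lk (exp_y A) (Inl i) = 0"
  by (simp_all add: exp_y_def lookup_sum lookup_single when_def)

lemma poly_mapping_sum_type_eqI:
  "(\<And>i. lk f (Inl i) = lk g (Inl i)) \<Longrightarrow> (\<And>i. lk f (Inr i) = lk g (Inr i)) \<Longrightarrow> f = g"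
  by (rule poly_mapping_eqI) (metis sum.exhaust)

lemma exp_y_Un: "A \<inter> B = {} \<Longrightarrow> exp_y (A \<union> B) = exp_y A + exp_y B"
  by (rule poly_mapping_sum_type_eqI) (auto simp: lookup_add lookup_exp_y)

lemma monom_sum: "monom (sum f A) = (\<Prod>i\<in>A. monom (f i))"
proof (induction A rule: infinite_finite_induct)
  case (insert i A)
  then show ?case by (simp add: monom_add)
qed (simp_all add: monom_def)

lemma u_eq_monom: "u p = monom (exp_x p + exp_y (- p))"
  by (simp add: u_def var_def monom_sum monom_add exp_x_def exp_y_def)

abbreviation mon_x :: "'n::finite set \<Rightarrow> ('n + 'n, 'k::field) mpoly" where
  "mon_x A \<equiv> monom (exp_x A)"

abbreviation mon_y :: "'n::finite set \<Rightarrow> ('n + 'n, 'k::field) mpoly" where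
  "mon_y A \<equiv> monom (exp_y A)"

text \<open>The usual alternating sign of a cubical or Koszul differential. The order on directions
  comes from an arbitrary enumeration of the subsets and does not depend on \<open>p\<close>; as it
  is strict, membership of \<open>A\<close> itself in \<open>T\<close> leaves the sign
  unchanged.\<close>

definition sg :: "'n::finite set \<Rightarrow> 'n set set \<Rightarrow> 'r::comm_ring_1" where
  "sg A T = (- 1) ^ card {B\<in>T. to_nat B < to_nat A}"

lemma sg_square [simp]: "sg A T * sg A T = 1"
  by (simp add: sg_def flip: power_add mult_2)

lemma sg_insert_self [simp]: "sg A (insert A T) = sg A T"
  by (simp add: sg_def) (metis (lifting) insert_iff less_irrefl)

lemma sg_Diff_self [simp]: "sg A (T - {A}) = sg A T"
  by (simp add: sg_def) (metis (lifting) insertE insert_Diff_single insert_iff less_irrefl singletonD)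

text \<open>Exactly one of \<open>A\<close> and \<open>B\<close> comes before the other in the
  enumeration, so exactly one of the two signs changes.\<close>

lemma sg_anticommute:
  assumes "A \<notin> T" "B \<in> T"
  shows "sg A T * sg B (insert A T) = - (sg B T * sg A (T - {B}))"
proof -
  have "A \<noteq> B" using assms by auto
  have ins: "sg B (insert A T) = (if to_nat A < to_nat B then - sg B T else sg B T)"
  proof (cases "to_nat A < to_nat B")
    case True
    then have "{C \<in> insert A T. to_nat C < to_nat B} = insert A {C \<in> T. to_nat C < to_nat B}" by auto
    then show ?thesis using True assms by (simp add: sg_def)
  next
    case False
    then have "{C \<in> insert A T. to_nat C < to_nat B} = {C \<in> T. to_nat C < to_nat B}" by auto
    then show ?thesis using False by (simp add: sg_def)
  qed
  have del: "sg A T = (if to_nat B < to_nat A then - sg A (T - {B}) else sg A (T - {B}))"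
  proof (cases "to_nat B < to_nat A")
    case True
    then have "{C \<in> T. to_nat C < to_nat A} = insert B {C \<in> T - {B}. to_nat C < to_nat A}"
      using assms by auto
    then show ?thesis using True by (simp add: sg_def)
  next
    case False
    then have "{C \<in> T. to_nat C < to_nat A} = {C \<in> T - {B}. to_nat C < to_nat A}" by auto
    then show ?thesis using False by (simp add: sg_def)
  qed
  have "to_nat A \<noteq> to_nat B" using \<open>A \<noteq> B\<close> by (simp add: inj_eq)
  then show ?thesis unfolding ins del by (cases "to_nat A < to_nat B") auto
qed

text \<open>The basis vector indexed by \<open>(p, T)\<close> is \<open>b(p; S)\<close> for \<open>S = {p - A | A. A \<in> T}\<close>.\<close>

type_synonym ('n, 'k) cell_module = "('n set \<times> 'n set set) \<Rightarrow>\<^sub>0 ('n + 'n, 'k) mpoly"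

text \<open>The difference of the two opposite facets in direction \<open>A\<close>. The monomials
  are the quotients of the degree of a cell by the degrees of these facets; \<open>T\<close> is
  already the set of directions of the facets.\<close>

definition face_diff :: "'n::finite set \<Rightarrow> 'n set \<Rightarrow> 'n set set \<Rightarrow> ('n, 'k::field) cell_module" where
  "face_diff A p T = fscale (mon_y A) (unit_vec (p, T)) - fscale (mon_x A) (unit_vec (p - A, T))"

text \<open>Defined on all pairs, cells of a lattice or not, so that \<open>bd_bd\<close> becomes an
  identity on the whole ambient module.\<close>

definition bd :: "'n::finite set \<times> 'n set set \<Rightarrow> ('n, 'k::field) cell_module" where
  "bd = (\<lambda>(p, T). \<Sum>A\<in>T. fscale (sg A T) (face_diff A p (T - {A})))"

section \<open>Cylinders in the direction of a set A, and the boundary of a boundary\<close>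

definition ins :: "'n::finite set \<Rightarrow> 'n set \<times> 'n set set \<Rightarrow> ('n, 'k::field) cell_module" where
  "ins A = (\<lambda>(p, T). fscale (sg A T) (unit_vec (p, insert A T)))"

definition del :: "'n::finite set \<Rightarrow> 'n set \<times> 'n set set \<Rightarrow> ('n, 'k::field) cell_module" where
  "del A = (\<lambda>(p, T). fscale (sg A T) (unit_vec (p, T - {A})))"

definition shift :: "'n::finite set \<Rightarrow> 'n set \<times> 'n set set \<Rightarrow> ('n, 'k::field) cell_module" where
  "shift A = (\<lambda>(p, T). unit_vec (p - A, T))"

lemma lift_ins_face_diff:
  "lift (ins A) (face_diff B p T) = fscale (sg A T) (face_diff B p (insert A T))"
  by (simp add: face_diff_def lift_diff lift_scale ins_def fmod.scale_right_diff_distrib mult.commute)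

text \<open>The two facets in direction \<open>A\<close> give the term
  \<open>face_diff A p T\<close>. All other facets still have the direction \<open>A\<close>, and
  \<open>sg_anticommute\<close> gives them the opposite sign.\<close>

lemma bd_ins_unit:
  assumes "A \<notin> T"
  shows "lift bd (ins A (p, T)) = face_diff A p T - lift (ins A) (bd (p, T))"
proof -
  have TA: "insert A T - {A} = T" using assms by auto
  have "lift bd (ins A (p, T)) = fscale (sg A T) (bd (p, insert A T))"
    by (simp add: ins_def lift_scale)
  also have "bd (p, insert A T) = fscale (sg A T) (face_diff A p T) +
      (\<Sum>B\<in>T. fscale (sg B (insert A T)) (face_diff B p (insert A T - {B})))"
    using assms TA by (simp add: bd_def)
  also have "fscale (sg A T) \<dots> = face_diff A p T +
      (\<Sum>B\<in>T. fscale (sg A T * sg B (insert A T)) (face_diff B p (insert A T - {B})))"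
    by (simp add: fmod.scale_right_distrib fmod.scale_sum_right)
  also have "(\<Sum>B\<in>T. fscale (sg A T * sg B (insert A T)) (face_diff B p (insert A T - {B})))
      = (\<Sum>B\<in>T. - fscale (sg B T * sg A (T - {B})) (face_diff B p (insert A (T - {B}))))"
  proof (rule sum.cong[OF refl])
    fix B assume B: "B \<in> T"
    then have "insert A T - {B} = insert A (T - {B})" using assms by auto
    then show "fscale (sg A T * sg B (insert A T)) (face_diff B p (insert A T - {B})) =
        - fscale (sg B T * sg A (T - {B})) (face_diff B p (insert A (T - {B})))"
      unfolding sg_anticommute[OF assms B] by simp
  qed
  also have "\<dots> = - lift (ins A) (bd (p, T))"
    by (simp add: bd_def lift_sum lift_scale lift_ins_face_diff sum_negf)
  finally show ?thesis by simp
qed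

text \<open>\<open>ins A\<close> is a chain homotopy between multiplication by \<open>y\<^sub>A\<close> and the shift by \<open>x\<^sub>A\<close>.\<close>

lemma bd_ins:
  assumes "z \<in> supported {k. A \<notin> snd k}"
  shows "lift bd (lift (ins A) z) =
    fscale (mon_y A) z - fscale (mon_x A) (lift (shift A) z) - lift (ins A) (lift bd z)"
proof -
  have "lift bd (lift (ins A) z) = lift (\<lambda>k. fscale (mon_y A) (unit_vec k) -
      fscale (mon_x A) (shift A k) - lift (ins A) (bd k)) z"
    unfolding lift_lift
    by (rule lift_cong[OF assms]) (auto simp: bd_ins_unit face_diff_def shift_def)
  also have "\<dots> = lift (\<lambda>k. fscale (mon_y A) (unit_vec k)) z -
      lift (\<lambda>k. fscale (mon_x A) (shift A k)) z - lift (\<lambda>k. lift (ins A) (bd k)) z"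
    by (simp add: lift_def[of _ z] fmod.scale_right_diff_distrib sum_subtractf)
  also have "lift (\<lambda>k. fscale (mon_x A) (shift A k)) z = fscale (mon_x A) (lift (shift A) z)"
    by (simp add: lift_def[of _ z] fmod.scale_sum_right mult.commute)
  also have "lift (\<lambda>k. fscale (mon_y A) (unit_vec k)) z = fscale (mon_y A) (lift unit_vec z)"
    by (simp add: lift_def[of _ z] fmod.scale_sum_right mult.commute)
  finally show ?thesis by (simp add: lift_unit_vec_eq lift_lift)
qed

lemma bd_shift: "lift bd (lift (shift A) z) = lift (shift A) (lift bd z)"
proof -
  have "bd (p - A, T) = lift (shift A) (bd (p, T))" for p :: "'a set" and T
  proof -
    have "p - A - B = p - (A \<union> B)" "p - B - A = p - (A \<union> B)" for B by auto
    then show ?thesis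
      by (simp add: bd_def lift_sum lift_scale face_diff_def lift_diff shift_def)
  qed
  then show ?thesis
    unfolding lift_lift by (intro arg_cong[of _ _ "\<lambda>f. lift f z"] ext) (auto simp: shift_def)
qed

lemma bd_supported_notin:
  assumes "z \<in> supported {k. A \<notin> snd k}"
  shows "lift bd z \<in> supported {k. A \<notin> snd k}"
proof (rule lift_in_subspace[OF subspace_supported assms])
  fix k :: "'a set \<times> 'a set set" assume "k \<in> {k. A \<notin> snd k}"
  then show "bd k \<in> supported {k. A \<notin> snd k}"
    unfolding bd_def face_diff_def
    by (auto split: prod.splits intro!: fmod.subspace_sum fmod.subspace_scale
          fmod.subspace_diff subspace_supported)
qed

text \<open>Instead of cancelling facets in pairs, directions are added one by one: up to sign, the
  new cell is \<open>ins A\<close> of the old one. Applying \<open>bd_ins\<close> to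
  \<open>e\<close> and then to its boundary makes everything cancel except \<open>ins A\<close> of
  the double boundary of \<open>e\<close>, which is zero by induction.\<close>

lemma bd_bd_unit: "lift bd (bd (p, T)) = 0"
  using finite[of T]
proof (induction T rule: finite_induct)
  case empty
  then show ?case by (simp add: bd_def)
next
  case (insert A T)
  define e :: "('a, 'b) cell_module" where "e = unit_vec (p, T)"
  have e: "e \<in> supported {k. A \<notin> snd k}" using insert by (simp add: e_def)
  have De: "lift bd e \<in> supported {k. A \<notin> snd k}" by (rule bd_supported_notin[OF e])
  have "bd (p, insert A T) = fscale (sg A T) (lift bd (lift (ins A) e))"
    by (simp add: e_def ins_def lift_scale)
  also have "lift bd \<dots> = fscale (sg A T) (lift bd (fscale (mon_y A) e -
      fscale (mon_x A) (lift (shift A) e) - lift (ins A) (lift bd e)))"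
    by (simp add: bd_ins[OF e] lift_scale)
  also have "\<dots> = 0"
    using insert by (simp add: lift_diff lift_scale bd_ins[OF De] bd_shift) (simp add: e_def)
  finally show ?case .
qed

lemma bd_bd: "lift bd (lift bd z) = 0"
proof -
  have "(\<lambda>k. lift bd (bd k)) = (\<lambda>k. 0 :: ('a, 'b) cell_module)"
    by (auto simp: bd_bd_unit)
  then show ?thesis by (simp add: lift_lift) (simp add: lift_def)
qed

lemma ins_del:
  assumes "z \<in> supported {k. A \<in> snd k}"
  shows "lift (ins A) (lift (del A) z) = z"
proof -
  have "lift (ins A) (lift (del A) z) = lift unit_vec z"
    unfolding lift_lift
    by (rule lift_cong[OF assms]) (auto simp: del_def ins_def lift_scale insert_absorb)
  then show ?thesis by (simp add: lift_unit_vec_eq)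
qed

text \<open>Extended by zero to cells of positive dimension, so that cycles of all dimensions can be
  treated by one exactness statement.\<close>

definition aug :: "('n::finite, 'k::field) cell_module \<Rightarrow> ('n + 'n, 'k) mpoly" where
  "aug z = (\<Sum>k\<in>UNIV. lk z k * (if snd k = {} then u (fst k) else 0))"

lemma aug_add: "aug (x + y) = aug x + aug y"
  by (simp add: aug_def lookup_add distrib_right sum.distrib)

lemma aug_diff: "aug (x - y) = aug x - aug y"
  by (simp add: aug_def lookup_minus left_diff_distrib sum_subtractf)

lemma aug_scale: "aug (fscale r x) = r * aug x"
  by (simp add: aug_def sum_distrib_left mult.assoc)

lemma aug_0 [simp]: "aug 0 = 0"
  by (simp add: aug_def)

lemma aug_sum: "aug (sum f I) = (\<Sum>i\<in>I. aug (f i))"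
  by (induction I rule: infinite_finite_induct) (simp_all add: aug_add)

lemma aug_unit_vec [simp]: "aug (unit_vec k) = (if snd k = {} then u (fst k) else 0)"
proof -
  have "aug (unit_vec k) = (\<Sum>i\<in>UNIV. if i = k then (if snd k = {} then u (fst k) else 0) else 0)"
    unfolding aug_def by (intro sum.cong) (auto simp: lookup_single when_def)
  then show ?thesis by simp
qed

lemma aug_lift: "aug (lift f z) = (\<Sum>k\<in>UNIV. lk z k * aug (f k))"
  by (simp add: lift_def aug_sum aug_scale)

text \<open>Exponent form of the relation y_A u_p = x_A u_(p-A), the binomial syzygy given by an
  edge of the complex.\<close>

lemma exp_face:
  assumes "A \<subseteq> p"
  shows "exp_y A + (exp_x p + exp_y (- p)) = exp_x A + (exp_x (p - A) + exp_y (- (p - A)))"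
  using assms by (intro poly_mapping_sum_type_eqI) (auto simp: lookup_add lookup_exp_x lookup_exp_y)

lemma aug_face_diff: "A \<subseteq> p \<Longrightarrow> aug (face_diff A p T) = 0"
  by (simp add: face_diff_def aug_diff aug_scale u_eq_monom exp_face flip: monom_add)

lemma aug_bd:
  assumes "z \<in> supported {(p, T). \<Union>T \<subseteq> p}"
  shows "aug (lift bd z) = 0"
  unfolding aug_lift
proof (rule sum.neutral, rule ballI)
  fix k :: "'a set \<times> 'a set set"
  obtain p T where k: "k = (p, T)" by (cases k)
  show "lk z k * aug (bd k) = 0"
  proof (cases "\<Union>T \<subseteq> p")
    case True
    then have "aug (face_diff A p (T - {A})) = (0 :: ('a + 'a, 'b) mpoly)" if "A \<in> T" for A
      using that by (intro aug_face_diff) auto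
    then have "aug (bd k) = (0 :: ('a + 'a, 'b) mpoly)"
      by (simp add: k bd_def aug_sum aug_scale)
    then show ?thesis by simp
  next
    case False
    then show ?thesis using assms by (auto simp: supported_iff k)
  qed
qed

section \<open>Coefficients without a given monomial factor\<close>

definition coeffs_avoid :: "('v \<Rightarrow>\<^sub>0 nat) \<Rightarrow> ('i \<Rightarrow>\<^sub>0 ('v, 'k::field) mpoly) \<Rightarrow> bool" where
  "coeffs_avoid m z \<longleftrightarrow> (\<forall>k. avoids m (lk z k))"

lemma coeffs_avoid_sum: "(\<And>i. i \<in> I \<Longrightarrow> coeffs_avoid m (f i)) \<Longrightarrow> coeffs_avoid m (sum f I)"
  by (simp add: coeffs_avoid_def lookup_sum avoids_sum)

lemma coeffs_avoid_diff: "coeffs_avoid m x \<Longrightarrow> coeffs_avoid m y \<Longrightarrow> coeffs_avoid m (x - y)"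
  by (simp add: coeffs_avoid_def lookup_minus avoids_diff)

lemma coeffs_avoid_unit_vec: "avoids m f \<Longrightarrow> coeffs_avoid m (fscale f (unit_vec k))"
  by (simp add: coeffs_avoid_def lookup_single when_def)

lemma fscale_monom_decomp:
  fixes z :: "'i::finite \<Rightarrow>\<^sub>0 ('v, 'k::field) mpoly"
  assumes "z \<in> supported K"
  obtains z' z'' where "z = fscale (monom m) z' + z''" "coeffs_avoid m z''"
    "z' \<in> supported K" "z'' \<in> supported K"
proof -
  have "\<exists>g h. lk z k = monom m * g + h \<and> avoids m h" for k
    using monom_times_decomp by metis
  then obtain g h where gh: "\<And>k. lk z k = monom m * g k + h k" "\<And>k. avoids m (h k)"
    by metis
  define z' where "z' = (\<Sum>k\<in>K. fscale (g k) (unit_vec k))"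
  define z'' where "z'' = (\<Sum>k\<in>K. fscale (h k) (unit_vec k))"
  have lk_sum: "lk (\<Sum>k\<in>K. fscale (f k) (unit_vec k)) k = (if k \<in> K then f k else 0)"
    for f :: "'i \<Rightarrow> ('v, 'k) mpoly" and k
  proof -
    have "lk (\<Sum>k\<in>K. fscale (f k) (unit_vec k)) k = (\<Sum>i\<in>K. if i = k then f k else 0)"
      unfolding lookup_sum by (intro sum.cong) (auto simp: lookup_single when_def)
    then show ?thesis by simp
  qed
  show thesis
  proof
    show "z = fscale (monom m) z' + z''"
    proof (rule poly_mapping_eqI)
      fix k
      show "lk z k = lk (fscale (monom m) z' + z'') k"
        using assms by (cases "k \<in> K")
          (simp_all add: lookup_add z'_def z''_def lk_sum supported_iff flip: gh(1))
    qed
    show "coeffs_avoid m z''"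
      unfolding z''_def by (intro coeffs_avoid_sum coeffs_avoid_unit_vec gh)
  qed (auto simp: z'_def z''_def supported_iff lk_sum)
qed

lemma fscale_monom_add_eq_0:
  assumes "fscale (monom m) x + y = 0" "coeffs_avoid m y"
  shows "x = 0" "y = 0"
proof -
  have "monom m * lk x k + lk y k = 0" for k
    using arg_cong[OF assms(1), of "\<lambda>z. lk z k"] by (simp add: lookup_add)
  moreover have "avoids m (lk y k)" for k
    using assms(2) by (simp add: coeffs_avoid_def del: split_paired_All)
  ultimately have "lk x k = 0" "lk y k = 0" for k
    using monom_times_add_eq_0[of m "lk x k" "lk y k"] by blast+
  then show "x = 0" "y = 0" by (auto intro: poly_mapping_eqI)
qed

lemma avoids_exp_y_face:
  assumes "A \<inter> B = {}" "avoids (exp_y A) f"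
  shows "avoids (exp_y A) (mon_x B * f)" "avoids (exp_y A) (mon_y B * f)"
proof -
  have *: "lk (exp_y A) v = 0 \<or> lk (exp_x B) v = 0" "lk (exp_y A) v = 0 \<or> lk (exp_y B) v = 0" for v
    using assms by (cases v; auto simp: lookup_exp_x lookup_exp_y)+
  show "avoids (exp_y A) (mon_x B * f)" "avoids (exp_y A) (mon_y B * f)"
    by (rule avoids_monom_times[OF assms(2)], rule *)+
qed

lemma avoids_mult_sg: "avoids m f \<Longrightarrow> avoids m (f * sg A T)"
  by (cases "even (card {B \<in> T. to_nat B < to_nat A})") (simp_all add: sg_def avoids_uminus)

text \<open>Every direction \<open>B\<close> of a cell in question is disjoint from
  \<open>A\<close>, so neither x_B nor y_B shares a variable with y_A.\<close>

lemma coeffs_avoid_bd: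
  assumes "z \<in> supported {(p, T). A \<inter> \<Union>T = {}}" "coeffs_avoid (exp_y A) z"
  shows "coeffs_avoid (exp_y A) (lift bd z)"
  unfolding lift_def
proof (rule coeffs_avoid_sum)
  fix k :: "'a set \<times> 'a set set"
  obtain p T where k: "k = (p, T)" by (cases k)
  have f: "avoids (exp_y A) (lk z k)" using assms(2) by (simp add: coeffs_avoid_def del: split_paired_All)
  show "coeffs_avoid (exp_y A) (fscale (lk z k) (bd k))"
  proof (cases "A \<inter> \<Union>T = {}")
    case True
    have "coeffs_avoid (exp_y A) (fscale (lk z k * sg B T) (face_diff B p (T - {B})))"
      if "B \<in> T" for B
    proof -
      have "avoids (exp_y A) (lk z k * sg B T)"
        using f by (rule avoids_mult_sg)
      moreover have "A \<inter> B = {}" using True that by auto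
      ultimately show ?thesis
        unfolding face_diff_def fmod.scale_right_diff_distrib fmod.scale_scale
          mult.commute[of "lk z k * sg B T"]
        by (intro coeffs_avoid_diff coeffs_avoid_unit_vec avoids_exp_y_face)
    qed
    then show ?thesis
      by (simp add: k bd_def fmod.scale_sum_right coeffs_avoid_sum)
  next
    case False
    then have "lk z k = 0" using assms(1) by (auto simp: supported_iff k)
    then show ?thesis by (simp add: coeffs_avoid_def)
  qed
qed

text \<open>When \<open>p\<close> contains \<open>A\<close>, the monomial u_p involves no y_i with i
  in \<open>A\<close>. Together with \<open>mon_y_dvd_aug\<close> this separates the augmentations
  of the two parts in \<open>acyclic\<close>.\<close>

lemma avoids_aug:
  assumes "z \<in> supported {(p, T). A \<subseteq> p}" "coeffs_avoid (exp_y A) z"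
  shows "avoids (exp_y A) (aug z)"
  unfolding aug_def
proof (rule avoids_sum)
  fix k :: "'a set \<times> 'a set set"
  have f: "avoids (exp_y A) (lk z k)" using assms(2) by (simp add: coeffs_avoid_def del: split_paired_All)
  show "avoids (exp_y A) (lk z k * (if snd k = {} then u (fst k) else 0))"
  proof (cases "A \<subseteq> fst k")
    case True
    have "avoids (exp_y A) (monom (exp_x (fst k) + exp_y (- fst k)) * lk z k)"
    proof (rule avoids_monom_times[OF f])
      show "lk (exp_y A) v = 0 \<or> lk (exp_x (fst k) + exp_y (- fst k)) v = 0" for v
        using True by (cases v) (auto simp: lookup_add lookup_exp_x lookup_exp_y)
    qed
    then show ?thesis by (simp add: u_eq_monom mult.commute)
  next
    case False
    then have "lk z k = 0" using assms(1) by (cases k) (simp add: supported_iff)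
    then show ?thesis by simp
  qed
qed

text \<open>When \<open>p\<close> misses \<open>A\<close>, all y_i with i in \<open>A\<close> occur
  in u_p.\<close>

lemma mon_y_dvd_aug:
  assumes "z \<in> supported {(p, T). A \<inter> p = {}}"
  shows "mon_y A dvd aug z"
  unfolding aug_def
proof (rule dvd_sum)
  fix k :: "'a set \<times> 'a set set"
  show "mon_y A dvd lk z k * (if snd k = {} then u (fst k) else 0)"
  proof (cases "A \<inter> fst k = {}")
    case True
    then have "A \<inter> (- fst k - A) = {}" "- fst k = A \<union> (- fst k - A)" by auto
    then have "exp_y (- fst k) = exp_y A + exp_y (- fst k - A)"
      using exp_y_Un by metis
    then have "u (fst k) = mon_y A * (mon_x (fst k) * mon_y (- fst k - A) :: ('a + 'a, 'b) mpoly)"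
      by (simp add: u_eq_monom monom_add mult.left_commute)
    then show ?thesis by (simp add: mult.left_commute)
  next
    case False
    then have "lk z k = 0" using assms(1) by (cases k) (simp add: supported_iff)
    then show ?thesis by simp
  qed
qed

section \<open>Exactness\<close>

context set_lattice
begin

section \<open>Faces of cells and the splitting of an interval along a block\<close>

lemma cells_disjoint:
  assumes "(p, T) \<in> cells a b" "A \<in> T"
  shows "A \<inter> \<Union>(T - {A}) = {}"
  using assms blocks_disjoint[of A p] by (fastforce simp: cells_def)

lemma cells_face:
  assumes "(p, T) \<in> cells a b" "A \<in> T"
  shows "(p, T - {A}) \<in> cells a b" "(p - A, T - {A}) \<in> cells a b"
proof -
  have A: "A \<in> blocks p" using assms by (auto simp: cells_def)
  then show "(p, T - {A}) \<in> cells a b" using assms by (auto simp: cells_def)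
  have "T - {A} \<subseteq> blocks (p - A)"
    using assms blocks_Diff[OF A] by (auto simp: cells_def)
  moreover have "p - A \<in> L" using A blocksD by auto
  ultimately show "(p - A, T - {A}) \<in> cells a b" using assms by (auto simp: cells_def)
qed

lemma bd_unit_supported_cells:
  assumes "k \<in> cells a b"
  shows "bd k \<in> supported (cells a b)"
proof -
  obtain p T where k: "k = (p, T)" by (cases k)
  show ?thesis
    unfolding k bd_def face_diff_def using assms cells_face[of p T a b] k
    by (auto intro!: fmod.subspace_sum fmod.subspace_scale fmod.subspace_diff subspace_supported)
qed

lemma bd_supported_cells:
  "z \<in> supported (cells a b) \<Longrightarrow> lift bd z \<in> supported (cells a b)"
  by (rule lift_in_subspace[OF subspace_supported]) (auto intro: bd_unit_supported_cells)

lemma aug_bd_cells: "z \<in> supported (cells a b) \<Longrightarrow> aug (lift bd z) = 0"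
  by (rule aug_bd, erule supported_mono) (auto simp: cells_def dest: blocksD)

text \<open>Base case of the induction: the interval is a point or empty, and directions are
  nonempty, so a cell in it has none.\<close>

lemma cells_trivial:
  assumes "\<not> a \<subset> b"
  shows "cells a b \<subseteq> {(a, {})}"
proof
  fix k assume k: "k \<in> cells a b"
  obtain p T where pT: "k = (p, T)" by (cases k)
  have "a \<subseteq> p - \<Union>T" "p \<subseteq> b" "T \<subseteq> blocks p" using k by (auto simp: pT cells_def)
  with assms have "p = a" "p - \<Union>T = p" by auto
  moreover have "B \<subseteq> p \<and> B \<noteq> {}" if "B \<in> T" for B
    using \<open>T \<subseteq> blocks p\<close> that blocksD(1,2)[of B p] by auto
  ultimately have "T = {}" by blast
  then show "k \<in> {(a, {})}" by (simp add: pT \<open>p = a\<close>)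
qed

text \<open>By \<open>blocks_below\<close>, a cell without direction \<open>A\<close> has a top that
  misses \<open>A\<close>, hence lies below \<open>b - A\<close>, or a top with block
  \<open>A\<close>. In the latter case its directions are disjoint from \<open>A\<close>, so its
  bottom still contains \<open>A\<close> and lies above \<open>a'\<close>. The last three claims say
  where \<open>ins A\<close>, \<open>del A\<close> and \<open>shift A\<close> send cells.\<close>

lemma cells_split:
  assumes A: "A \<in> blocks b" "a \<subseteq> b - A"
    and a': "a' \<in> L" "a \<union> A \<subseteq> a'" "\<And>p. p \<in> L \<Longrightarrow> a \<union> A \<subseteq> p \<Longrightarrow> a' \<subseteq> p"
  shows "cells a b = {k \<in> cells a b. A \<in> snd k} \<union> cells a' b \<union> cells a (b - A)"
    and "cells a' b \<subseteq> {(p, T). A \<in> blocks p \<and> A \<inter> \<Union>T = {} \<and> A \<notin> T}"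
    and "cells a (b - A) \<subseteq> {(p, T). A \<inter> p = {} \<and> A \<notin> T}"
    and "\<And>p T. (p, T) \<in> cells a' b \<Longrightarrow> (p, insert A T) \<in> cells a b"
    and "\<And>p T. (p, T) \<in> cells a b \<Longrightarrow> A \<in> T \<Longrightarrow> (p, T - {A}) \<in> cells a' b"
    and "\<And>p T. (p, T) \<in> cells a' b \<Longrightarrow> (p - A, T) \<in> cells a (b - A)"
proof -
  have ne: "A \<noteq> {}" and Ab: "A \<subseteq> b" using A blocksD by auto
  have below: "A \<inter> p = {} \<or> A \<in> blocks p" if "(p, T) \<in> cells a0 b" for p T a0
    using that blocks_below[OF A(1), of p] by (auto simp: cells_def)
  show mem: "cells a' b \<subseteq> {(p, T). A \<in> blocks p \<and> A \<inter> \<Union>T = {} \<and> A \<notin> T}"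
  proof clarify
    fix p T assume pT: "(p, T) \<in> cells a' b"
    then have "A \<subseteq> p - \<Union>T" using a' by (auto simp: cells_def)
    then show "A \<in> blocks p \<and> A \<inter> \<Union>T = {} \<and> A \<notin> T" using below[OF pT] ne by auto
  qed
  show nonmem: "cells a (b - A) \<subseteq> {(p, T). A \<inter> p = {} \<and> A \<notin> T}"
  proof
    fix k assume k: "k \<in> cells a (b - A)"
    obtain p T where "k = (p, T)" by (cases k)
    then show "k \<in> {(p, T). A \<inter> p = {} \<and> A \<notin> T}"
      using k ne blocksD(1)[of A p] by (auto simp: cells_def)
  qed
  show del: "(p, T - {A}) \<in> cells a' b" if pT: "(p, T) \<in> cells a b" "A \<in> T" for p T
  proof -
    have *: "p \<in> L" "T - {A} \<subseteq> blocks p" "A \<in> blocks p" "p \<subseteq> b" "a \<subseteq> p - \<Union>T"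
      using pT by (auto simp: cells_def)
    have "A \<subseteq> p - \<Union>(T - {A})"
      using cells_disjoint[OF pT] blocksD(1)[OF *(3)] by auto
    then have "a' \<subseteq> p - \<Union>(T - {A})"
      using * by (intro a'(3) Diff_blocks_closed) auto
    then show ?thesis using * by (simp add: cells_def)
  qed
  show "(p, insert A T) \<in> cells a b" if "(p, T) \<in> cells a' b" for p T
  proof -
    have "A \<in> blocks p" using that mem by auto
    then show ?thesis using that A(2) a'(2) unfolding cells_def by blast
  qed
  show "(p - A, T) \<in> cells a (b - A)" if pT: "(p, T) \<in> cells a' b" for p T
  proof -
    have *: "A \<in> blocks p" "A \<notin> T" using pT mem by auto
    have "T \<subseteq> blocks (p - A)"
      using pT blocks_Diff[OF *(1)] *(2) by (fastforce simp: cells_def)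
    then show ?thesis
      using pT A a' blocksD(3)[OF *(1)] by (auto simp: cells_def)
  qed
  show "cells a b = {k \<in> cells a b. A \<in> snd k} \<union> cells a' b \<union> cells a (b - A)" (is "_ = ?r")
  proof
    show "?r \<subseteq> cells a b" using a' by (auto simp: cells_def)
    show "cells a b \<subseteq> ?r"
    proof
      fix k assume k: "k \<in> cells a b"
      show "k \<in> ?r"
      proof (rule ccontr)
        obtain p T where k_eq: "k = (p, T)" by (cases k)
        assume "k \<notin> ?r"
        then have pT: "(p, T) \<in> cells a b" "(p, T) \<notin> cells a (b - A)" "(p, T) \<notin> cells a' b" "A \<notin> T"
          using k by (auto simp: k_eq)
        then have "A \<in> blocks p" using below[OF pT(1)] by (auto simp: cells_def)
        have "a' \<subseteq> p - \<Union>T"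
        proof (rule a'(3))
          show "p - \<Union>T \<in> L" using pT by (auto simp: cells_def intro: Diff_blocks_closed)
          have "A \<inter> B = {}" if "B \<in> T" for B
            using that pT(1,4) \<open>A \<in> blocks p\<close> by (intro blocks_disjoint) (auto simp: cells_def)
          then show "a \<union> A \<subseteq> p - \<Union>T"
            using pT(1) blocksD(1)[OF \<open>A \<in> blocks p\<close>] by (auto simp: cells_def)
        qed
        then show False using pT by (auto simp: cells_def)
      qed
    qed
  qed
qed

lemma acyclic:
  assumes "a \<in> L" "b \<in> L" "z \<in> supported (cells a b)"
    and "lift bd z = 0" "aug z = (0 :: ('n + 'n, 'k::field) mpoly)"
  shows "\<exists>w\<in>supported (cells a b). lift bd w = z"
  using assms
proof (induction "card (b - a)" arbitrary: a b z rule: less_induct)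
  case less
  show ?case
  proof (cases "a \<subset> b")
    case False
    define f where "f = lk z (a, {})"
    have z_supp: "z \<in> supported {(a, {})}"
      using less.prems(3) cells_trivial[OF False] by (rule supported_mono)
    have z: "z = fscale f (unit_vec (a, {}))"
    proof (rule poly_mapping_eqI)
      fix k
      show "lk z k = lk (fscale f (unit_vec (a, {}))) k"
        using z_supp
        by (cases "k = (a, {})") (simp_all add: f_def supported_iff lookup_single when_def del: split_paired_All)
    qed
    have "f * u a = 0" using less.prems(5) by (simp add: z aug_scale)
    \<comment> \<open>Cancelling \<open>u a\<close> is uniqueness of division by that monomial, with
      remainder \<open>0\<close>.\<close>
    then have "f = 0"
      using monom_times_add_eq_0(1)[of "exp_x a + exp_y (- a)" f 0]
      by (simp add: u_eq_monom mult.commute)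
    then show ?thesis
      by (intro bexI[of _ 0]) (auto simp: z supported_iff)
  next
    case True
    then obtain A where A: "A \<in> blocks b" "a \<subseteq> b - A"
      using exists_block less.prems by blast
    have Ab: "A \<subseteq> b" "A \<noteq> {}" "b - A \<in> L" using A blocksD by auto
    obtain a' where a': "a' \<in> L" "a \<union> A \<subseteq> a'" "a' \<subseteq> b" "\<And>p. p \<in> L \<Longrightarrow> a \<union> A \<subseteq> p \<Longrightarrow> a' \<subseteq> p"
      using exists_least_above[of b "a \<union> A"] less.prems True Ab by blast
    note split = cells_split[OF A a'(1,2,4)]
    \<comment> \<open>\<open>C1\<close> is the body of the cylinder and \<open>C2\<close> its upper
      end; \<open>shift A\<close> sends \<open>C2\<close> to the lower end, inside
      \<open>C3\<close>. Every chain on \<open>C1\<close> is \<open>ins A\<close> of a chain on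
      \<open>C2\<close>, obtained by \<open>del A\<close>.\<close>
    define C1 where "C1 = {k \<in> cells a b. A \<in> snd k}"
    define C2 where "C2 = cells a' b"
    define C3 where "C3 = cells a (b - A)"
    have cells_eq: "cells a b = C1 \<union> C2 \<union> C3" unfolding C1_def C2_def C3_def by (rule split(1))
    have C2: "C2 \<subseteq> {(p, T). A \<in> blocks p \<and> A \<inter> \<Union>T = {} \<and> A \<notin> T}"
      unfolding C2_def by (rule split(2))
    have C3: "C3 \<subseteq> {(p, T). A \<inter> p = {} \<and> A \<notin> T}"
      unfolding C3_def by (rule split(3))
    have C2_sub: "C2 \<subseteq> {(p, T). A \<subseteq> p}"
      using C2 blocksD(1)[of A] by blast
    then have disj: "C1 \<inter> C2 = {}" "C1 \<inter> C3 = {}" "C2 \<inter> C3 = {}"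
      using C2 C3 Ab(2) by (fastforce simp: C1_def)+
    have ins_C2: "lift (ins A) x \<in> supported C1" if "x \<in> supported C2" for x :: "('n, 'k) cell_module"
      using that unfolding C2_def
      by (rule lift_in_subspace[OF subspace_supported])
        (auto simp: ins_def C1_def intro!: fmod.subspace_scale[OF subspace_supported] split(4))
    have del_C1: "lift (del A) x \<in> supported C2" if "x \<in> supported C1" for x :: "('n, 'k) cell_module"
      using that
      by (rule lift_in_subspace[OF subspace_supported])
        (auto simp: del_def C1_def C2_def intro!: fmod.subspace_scale[OF subspace_supported] split(5))
    have shift_C2: "lift (shift A) x \<in> supported C3" if "x \<in> supported C2" for x :: "('n, 'k) cell_module"
      using that unfolding C2_def
      by (rule lift_in_subspace[OF subspace_supported])
        (auto simp: shift_def C3_def intro!: split(6))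
    have bd_C2: "lift bd x \<in> supported C2" if "x \<in> supported C2" for x :: "('n, 'k) cell_module"
      using that bd_supported_cells by (simp add: C2_def)
    have bd_C3: "lift bd x \<in> supported C3" if "x \<in> supported C3" for x :: "('n, 'k) cell_module"
      using that bd_supported_cells by (simp add: C3_def)
    have notin_C2: "x \<in> supported {k. A \<notin> snd k}" if "x \<in> supported C2" for x :: "('n, 'k) cell_module"
      using that C2 by (auto elim!: supported_mono)
    note sub = fmod.subspace_add[OF subspace_supported] fmod.subspace_diff[OF subspace_supported]
      fmod.subspace_scale[OF subspace_supported] fmod.subspace_neg[OF subspace_supported]

    text \<open>Modulo a boundary, \<open>z\<close> becomes \<open>s + r + t\<close>, with \<open>r\<close> in \<open>C2\<close> free of \<open>y\<^sub>A\<close> and \<open>t\<close> in \<open>C3\<close>;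
      comparing the \<open>C2\<close> parts of its boundary forces \<open>s = 0\<close>.\<close>
    obtain y r where y: "restr C2 z = fscale (mon_y A) y + r" "coeffs_avoid (exp_y A) r"
      "y \<in> supported C2" "r \<in> supported C2"
      by (rule fscale_monom_decomp[OF restr_supported])
    have z: "z = restr C1 z + restr C2 z + restr C3 z"
      using less.prems(3) disj
      by (intro poly_mapping_eqI) (auto simp: lookup_add lookup_restr supported_iff cells_eq)
    \<comment> \<open>By \<open>bd_ins\<close> the boundary of \<open>w1\<close> has y_A times
      \<open>y\<close> as its \<open>C2\<close> part, so subtracting it leaves just \<open>r\<close>
      there; \<open>s\<close> and \<open>t\<close> absorb the other terms.\<close>
    define w1 where "w1 = lift (ins A) y"
    define s where "s = restr C1 z + lift (ins A) (lift bd y)"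
    define t where "t = restr C3 z + fscale (mon_x A) (lift (shift A) y)"
    have s: "s \<in> supported C1" unfolding s_def by (intro sub restr_supported ins_C2 bd_C2 y)
    have t: "t \<in> supported C3" unfolding t_def by (intro sub restr_supported shift_C2 y)
    have z_w1: "z - lift bd w1 = s + r + t"
      unfolding w1_def bd_ins[OF notin_C2[OF y(3)]] s_def t_def
      by (subst z) (simp add: y(1))
    define s' where "s' = lift (del A) s"
    have s': "s' \<in> supported C2" unfolding s'_def by (rule del_C1[OF s])
    have s_eq: "s = lift (ins A) s'"
      unfolding s'_def using s by (subst ins_del) (auto simp: C1_def elim: supported_mono)
    have "0 = lift bd (z - lift bd w1)" by (simp add: lift_diff bd_bd less.prems(4))
    also have "\<dots> = (fscale (mon_y A) s' + lift bd r) +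
        (- lift (ins A) (lift bd s') + (lift bd t - fscale (mon_x A) (lift (shift A) s')))"
      by (simp add: z_w1 lift_add s_eq bd_ins[OF notin_C2[OF s']])
    finally have sum0: "(fscale (mon_y A) s' + lift bd r) +
        (- lift (ins A) (lift bd s') + (lift bd t - fscale (mon_x A) (lift (shift A) s'))) = 0" ..
    have "fscale (mon_y A) s' + lift bd r \<in> supported C2"
      by (intro sub bd_C2 s' y)
    moreover have "- lift (ins A) (lift bd s') + (lift bd t - fscale (mon_x A) (lift (shift A) s'))
        \<in> supported (C1 \<union> C3)"
    proof (intro sub)
      show "lift (ins A) (lift bd s') \<in> supported (C1 \<union> C3)"
        using ins_C2[OF bd_C2[OF s']] by (rule supported_mono) auto
      show "lift bd t \<in> supported (C1 \<union> C3)"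
        using bd_C3[OF t] by (rule supported_mono) auto
      show "lift (shift A) s' \<in> supported (C1 \<union> C3)"
        using shift_C2[OF s'] by (rule supported_mono) auto
    qed
    moreover have "C2 \<inter> (C1 \<union> C3) = {}" using disj by auto
    ultimately have "fscale (mon_y A) s' + lift bd r = 0"
      using supported_disjoint_sum_eq_0(1)[OF sum0] by blast
    \<comment> \<open>Each coefficient now expresses \<open>0\<close> as a multiple of y_A plus a
      remainder, so both vanish.\<close>
    moreover have "coeffs_avoid (exp_y A) (lift bd r)"
      using y(4) C2 by (intro coeffs_avoid_bd y(2)) (auto elim!: supported_mono)
    ultimately have s'0: "s' = 0" and bd_r: "lift bd r = 0"
      using fscale_monom_add_eq_0 by blast+
    then have bd_t: "lift bd t = 0" using sum0 by simp
    have z_eq: "z = lift bd w1 + r + t"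
      using z_w1 s'0 by (simp add: s_eq algebra_simps)
    have w1: "w1 \<in> supported C1" unfolding w1_def by (rule ins_C2[OF y(3)])
    then have "aug (lift bd w1) = 0"
      by (intro aug_bd_cells[of _ a b]) (auto simp: cells_eq elim: supported_mono)
    then have "aug t + aug r = 0"
      using less.prems(5) by (simp add: z_eq aug_add add.commute)
    \<comment> \<open>The ideal splits in the same way: \<open>aug t\<close> is a multiple of y_A
      and \<open>aug r\<close> a remainder, so they cannot cancel each other.\<close>
    moreover have "mon_y A dvd aug t"
      using t C3 by (intro mon_y_dvd_aug) (auto elim!: supported_mono)
    then obtain g where "aug t = mon_y A * g" ..
    moreover have "avoids (exp_y A) (aug r)"
      by (intro avoids_aug y(2) supported_mono[OF y(4) C2_sub])
    ultimately have aug: "aug r = 0" "aug t = 0"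
      using monom_times_add_eq_0[of "exp_y A" g "aug r"] by auto
    \<comment> \<open>Removing \<open>A\<close> from \<open>b\<close>, or passing from
      \<open>a\<close> up to \<open>a'\<close>, shortens the interval because \<open>A\<close> is
      nonempty and misses \<open>a\<close>.\<close>
    have "card (b - a') < card (b - a)"
      using a' A Ab True by (intro psubset_card_mono) auto
    then obtain w2 where w2: "w2 \<in> supported C2" "lift bd w2 = r"
      using less.hyps[of b a' r] y(4) bd_r aug a' less.prems by (auto simp: C2_def)
    have "card (b - A - a) < card (b - a)"
      using A Ab True by (intro psubset_card_mono) auto
    then obtain w3 where w3: "w3 \<in> supported C3" "lift bd w3 = t"
      using less.hyps[of "b - A" a t] t bd_t aug Ab less.prems by (auto simp: C3_def)
    have "w1 + w2 + w3 \<in> supported (cells a b)"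
      using w1 w2(1) w3(1) by (intro sub) (auto simp: cells_eq elim: supported_mono)
    then show ?thesis
      using w2(2) w3(2) z_eq by (intro bexI[of _ "w1 + w2 + w3"]) (auto simp: lift_add)
  qed
qed

end

section \<open>Multigraded structure\<close>

lemma multidegree_add: "multidegree (m + m') = multidegree m + multidegree m'"
  unfolding multidegree_def
  by (rule poly_mapping_eqI) (simp add: Poly_Mapping.map.rep_eq lookup_add when_def)

lemma multidegree_0 [simp]: "multidegree 0 = 0"
  unfolding multidegree_def by (rule poly_mapping_eqI) (simp add: Poly_Mapping.map.rep_eq)

section \<open>Homogeneous polynomials and graded free modules\<close>

lemma ring_comp_0 [simp]: "0 \<in> ring_comp a"
  by (simp add: ring_comp_def)

lemma ring_comp_mult: "f \<in> ring_comp a \<Longrightarrow> g \<in> ring_comp b \<Longrightarrow> f * g \<in> ring_comp (a + b)"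
  unfolding ring_comp_def using keys_mult[of f g] by (fastforce simp: multidegree_add)

lemma ring_comp_add: "f \<in> ring_comp a \<Longrightarrow> g \<in> ring_comp a \<Longrightarrow> f + g \<in> ring_comp a"
  unfolding ring_comp_def using keys_add[of f g] by fastforce

lemma ring_comp_uminus: "f \<in> ring_comp a \<Longrightarrow> - f \<in> ring_comp a"
  unfolding ring_comp_def by (simp add: in_keys_iff)

lemma ring_comp_diff: "f \<in> ring_comp a \<Longrightarrow> g \<in> ring_comp a \<Longrightarrow> f - g \<in> ring_comp a"
  using ring_comp_add[OF _ ring_comp_uminus] by fastforce

lemma ring_comp_sum: "(\<And>i. i \<in> I \<Longrightarrow> f i \<in> ring_comp a) \<Longrightarrow> sum f I \<in> ring_comp a"
  by (induction I rule: infinite_finite_induct) (auto intro: ring_comp_add)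

lemma ring_comp_monom: "monom m \<in> ring_comp (multidegree m)"
  by (simp add: ring_comp_def monom_def)

lemma ring_comp_sg: "sg A T \<in> ring_comp 0"
proof -
  have "(1 :: ('v, 'k::field) mpoly) \<in> ring_comp 0" by (simp add: ring_comp_def)
  then show ?thesis
    by (cases "even (card {B \<in> T. to_nat B < to_nat A})") (auto simp: sg_def ring_comp_uminus)
qed

text \<open>Degree \<open>a\<close> of the free module whose generator \<open>k\<close> sits in
  degree \<open>g k\<close>. Degrees are integer vectors, so \<open>a - g k\<close> may have
  negative entries; the ring component is then zero.\<close>

definition hcomp :: "'i set \<Rightarrow> ('i \<Rightarrow> ('v \<Rightarrow>\<^sub>0 int)) \<Rightarrow> ('v \<Rightarrow>\<^sub>0 int) \<Rightarrow>
    ('i \<Rightarrow>\<^sub>0 ('v, 'k::field) mpoly) set" where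
  "hcomp K g a = {z \<in> supported K. \<forall>k. lk z k \<in> ring_comp (a - g k)}"

lemma hcomp_0 [simp]: "0 \<in> hcomp K g a"
  by (simp add: hcomp_def supported_iff)

lemma hcomp_add: "x \<in> hcomp K g a \<Longrightarrow> y \<in> hcomp K g a \<Longrightarrow> x + y \<in> hcomp K g a"
  by (simp add: hcomp_def fmod.subspace_add[OF subspace_supported] lookup_add ring_comp_add)

lemma hcomp_diff: "x \<in> hcomp K g a \<Longrightarrow> y \<in> hcomp K g a \<Longrightarrow> x - y \<in> hcomp K g a"
  by (simp add: hcomp_def fmod.subspace_diff[OF subspace_supported] lookup_minus ring_comp_diff)

lemma hcomp_sum: "(\<And>i. i \<in> I \<Longrightarrow> f i \<in> hcomp K g a) \<Longrightarrow> sum f I \<in> hcomp K g a"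
  by (induction I rule: infinite_finite_induct) (auto intro: hcomp_add)

lemma hcomp_scale:
  assumes "r \<in> ring_comp a" "x \<in> hcomp K g b"
  shows "fscale r x \<in> hcomp K g (a + b)"
proof -
  have "r * lk x k \<in> ring_comp (a + b - g k)" for k
    using ring_comp_mult[OF assms(1), of "lk x k" "b - g k"] assms(2)
    by (simp add: hcomp_def add_diff_eq)
  then show ?thesis
    using assms(2) by (simp add: hcomp_def fmod.subspace_scale[OF subspace_supported])
qed

lemma hcomp_unit_vec: "k \<in> K \<Longrightarrow> unit_vec k \<in> hcomp K g (g k)"
  by (auto simp: hcomp_def lookup_single when_def ring_comp_def)

lemma lift_hcomp:
  assumes "x \<in> hcomp K g a" "\<And>k. k \<in> K \<Longrightarrow> f k \<in> hcomp K' g' (g k)"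
  shows "lift f x \<in> hcomp K' g' a"
  unfolding lift_def
proof (rule hcomp_sum)
  fix k
  show "fscale (lk x k) (f k) \<in> hcomp K' g' a"
  proof (cases "k \<in> K")
    case True
    have "lk x k \<in> ring_comp (a - g k)" using assms(1) by (simp add: hcomp_def)
    from hcomp_scale[OF this assms(2)[OF True]] show ?thesis by simp
  next
    case False
    then show ?thesis using assms(1) by (simp add: hcomp_def supported_iff)
  qed
qed

text \<open>The term with monomial \<open>m\<close> at the generator \<open>k\<close> can only occur
  in degree \<open>g k + multidegree m\<close>. Hence the sum determines its homogeneous components,
  which gives uniqueness of the decomposition.\<close>

lemma lookup_homogeneous_sum:
  assumes "\<And>a. lk c a \<in> hcomp K g a"
  shows "lk (lk (lk c a) k) m =
    (if g k + multidegree m = a then lk (lk (\<Sum>a\<in>Poly_Mapping.keys c. lk c a) k) m else 0)"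
proof -
  have zero: "lk (lk (lk c b) k) m = 0" if "g k + multidegree m \<noteq> b" for b
  proof -
    have "lk (lk c b) k \<in> ring_comp (b - g k)" using assms[of b] by (simp add: hcomp_def)
    then show ?thesis using that by (auto simp: ring_comp_def in_keys_iff algebra_simps)
  qed
  have "lk (lk (\<Sum>b\<in>Poly_Mapping.keys c. lk c b) k) m = (\<Sum>b\<in>Poly_Mapping.keys c. lk (lk (lk c b) k) m)"
    by (simp add: lookup_sum)
  also have "\<dots> = (\<Sum>b\<in>Poly_Mapping.keys c. if b = g k + multidegree m
      then lk (lk (lk c (g k + multidegree m)) k) m else 0)"
    using zero by (intro sum.cong) auto
  also have "\<dots> = lk (lk (lk c (g k + multidegree m)) k) m"
    by (simp add: in_keys_iff)
  finally show ?thesis using zero by auto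
qed

text \<open>Decompositions can be added, and \<open>x\<close> is a finite sum of single terms times
  basis vectors, each of which is homogeneous.\<close>

lemma homogeneous_decomp_exists:
  fixes x :: "'i::finite \<Rightarrow>\<^sub>0 ('v, 'k::field) mpoly"
  assumes "x \<in> supported K"
  shows "\<exists>c. (\<forall>a. lk c a \<in> hcomp K g a) \<and> x = (\<Sum>a\<in>Poly_Mapping.keys c. lk c a)"
    (is "?P x")
proof -
  have P_single: "?P y" if "y \<in> hcomp K g a" for y a
    using that by (intro exI[of _ "Poly_Mapping.single a y"]) (auto simp: lookup_single when_def)
  have P_add: "?P (y + z)" if P: "?P y" "?P z" for y z
  proof -
    obtain c c' where c: "\<And>a. lk c a \<in> hcomp K g a" "y = (\<Sum>a\<in>Poly_Mapping.keys c. lk c a)"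
      and c': "\<And>a. lk c' a \<in> hcomp K g a" "z = (\<Sum>a\<in>Poly_Mapping.keys c'. lk c' a)"
      using P by blast
    have "(\<Sum>a\<in>Poly_Mapping.keys (c + c'). lk (c + c') a) = y + z"
      unfolding c c' by (rule setsum_keys_plus_distrib) auto
    then show ?thesis using c c' by (intro exI[of _ "c + c'"]) (auto simp: lookup_add hcomp_add)
  qed
  have P_sum: "?P (sum f I)" if "\<And>i. i \<in> I \<Longrightarrow> ?P (f i)" "finite I" for f and I :: "'j set"
    using that(2,1)
  proof (induction I rule: finite_induct)
    case empty
    then show ?case using P_single[OF hcomp_0] by simp
  next
    case (insert i I)
    have "?P (f i)" using insert.prems by simp
    moreover have "?P (sum f I)" using insert.prems by (intro insert.IH) simp
    ultimately have "?P (f i + sum f I)" by (rule P_add)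
    then show ?case using insert.hyps by simp
  qed
  have P_monom: "?P (fscale (Poly_Mapping.single m (lk (lk x k) m)) (unit_vec k))" for k m
  proof (cases "k \<in> K")
    case True
    have "Poly_Mapping.single m (lk (lk x k) m) \<in> ring_comp (multidegree m)"
      by (simp add: ring_comp_def)
    from P_single[OF hcomp_scale[OF this hcomp_unit_vec[OF True]]] show ?thesis .
  next
    case False
    then have "lk x k = 0" using assms by (simp add: supported_iff)
    then show ?thesis using P_single[OF hcomp_0] by simp
  qed
  have mono: "f = (\<Sum>m\<in>Poly_Mapping.keys f. Poly_Mapping.single m (lk f m))" for f :: "('v, 'k) mpoly"
    by (rule poly_mapping_eqI) (auto simp: lookup_sum lookup_single when_def in_keys_iff)
  have "x = (\<Sum>k\<in>UNIV. fscale (lk x k) (unit_vec k))"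
    using lift_unit_vec_eq[of x] by (simp add: lift_def)
  also have "\<dots> = (\<Sum>k\<in>UNIV. \<Sum>m\<in>Poly_Mapping.keys (lk x k).
      fscale (Poly_Mapping.single m (lk (lk x k) m)) (unit_vec k))"
    by (subst mono) (simp add: fmod.scale_sum_left)
  finally have x: "x = \<dots>" .
  show ?thesis
    by (subst x) (intro P_sum P_monom finite finite_keys)
qed

lemma hcomp_multigraded_module:
  "multigraded_module fscale (supported K :: ('i::finite \<Rightarrow>\<^sub>0 ('v, 'k::field) mpoly) set) (hcomp K g)"
proof unfold_locales
  fix x :: "'i \<Rightarrow>\<^sub>0 ('v, 'k) mpoly" assume "x \<in> supported K"
  then have "\<exists>c. (\<forall>a. lk c a \<in> hcomp K g a) \<and> x = (\<Sum>a\<in>Poly_Mapping.keys c. lk c a)"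
    by (rule homogeneous_decomp_exists)
  moreover have "c = c'"
    if "(\<forall>a. lk c a \<in> hcomp K g a) \<and> x = (\<Sum>a\<in>Poly_Mapping.keys c. lk c a)"
      "(\<forall>a. lk c' a \<in> hcomp K g a) \<and> x = (\<Sum>a\<in>Poly_Mapping.keys c'. lk c' a)" for c c'
  proof (rule poly_mapping_eqI, rule poly_mapping_eqI, rule poly_mapping_eqI)
    fix a k m
    show "lk (lk (lk c a) k) m = lk (lk (lk c' a) k) m"
      using that lookup_homogeneous_sum[of c K g a k m] lookup_homogeneous_sum[of c' K g a k m]
      by metis
  qed
  ultimately show "\<exists>!c. (\<forall>a. lk c a \<in> hcomp K g a) \<and> x = (\<Sum>a\<in>Poly_Mapping.keys c. lk c a)"
    by blast
qed (auto simp: subspace_supported hcomp_diff hcomp_scale, auto simp: hcomp_def)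

section \<open>Bases of unit vectors and the ideal of the variables\<close>

lemma independent_unit_vec:
  "\<not> fmod.dependent (unit_vec ` K :: ('i \<Rightarrow>\<^sub>0 'r::comm_ring_1) set)"
proof
  assume "fmod.dependent (unit_vec ` K :: ('i \<Rightarrow>\<^sub>0 'r) set)"
  then obtain t r where t: "finite t" "t \<subseteq> unit_vec ` K" "(\<Sum>v\<in>t. fscale (r v) v) = (0 :: 'i \<Rightarrow>\<^sub>0 'r)"
    and "\<exists>v\<in>t. r v \<noteq> 0"
    unfolding fmod.dependent_explicit by auto
  then obtain k where k: "unit_vec k \<in> t" "r (unit_vec k) \<noteq> 0" by auto
  have "0 = (\<Sum>v\<in>t. r v * lk v k)"
    using arg_cong[OF t(3), of "\<lambda>z. lk z k"] by (simp add: lookup_sum)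
  also have "\<dots> = (\<Sum>v\<in>t. if v = unit_vec k then r (unit_vec k) else 0)"
    using t(2) by (intro sum.cong) (auto simp: lookup_single when_def)
  also have "\<dots> = r (unit_vec k)" using t(1) k(1) by simp
  finally show False using k(2) by simp
qed

lemma span_unit_vec:
  "fmod.span (unit_vec ` K) = (supported K :: ('i::finite \<Rightarrow>\<^sub>0 'r::comm_ring_1) set)"
proof
  show "fmod.span (unit_vec ` K) \<subseteq> (supported K :: ('i \<Rightarrow>\<^sub>0 'r) set)"
    by (rule fmod.span_minimal) (auto simp: subspace_supported)
  show "(supported K :: ('i \<Rightarrow>\<^sub>0 'r) set) \<subseteq> fmod.span (unit_vec ` K)"
  proof
    fix z :: "'i \<Rightarrow>\<^sub>0 'r" assume "z \<in> supported K"
    then have "lift unit_vec z \<in> fmod.span (unit_vec ` K)"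
      by (rule lift_in_subspace[OF fmod.subspace_span]) (auto intro: fmod.span_base)
    then show "z \<in> fmod.span (unit_vec ` K)" by (simp add: lift_unit_vec_eq)
  qed
qed

lemma family_basis_unit_vec:
  fixes h :: "'j \<Rightarrow> 'i::finite"
  assumes "inj_on h I" "h ` I = K"
  shows "family_basis fscale (supported K :: ('i \<Rightarrow>\<^sub>0 'r::comm_ring_1) set) I (\<lambda>j. unit_vec (h j))"
proof -
  have img: "(\<lambda>j. unit_vec (h j) :: 'i \<Rightarrow>\<^sub>0 'r) ` I = unit_vec ` K" using assms(2) by auto
  have "inj_on (\<lambda>j. unit_vec (h j) :: 'i \<Rightarrow>\<^sub>0 'r) I"
  proof (rule inj_onI)
    fix i j assume "i \<in> I" "j \<in> I" "(unit_vec (h i) :: 'i \<Rightarrow>\<^sub>0 'r) = unit_vec (h j)"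
    then have "lk (unit_vec (h i) :: 'i \<Rightarrow>\<^sub>0 'r) (h i) = lk (unit_vec (h j)) (h i)" by simp
    then have "h i = h j" by (auto simp: lookup_single when_def split: if_splits)
    then show "i = j" using assms(1) \<open>i \<in> I\<close> \<open>j \<in> I\<close> by (simp add: inj_on_eq_iff)
  qed
  then show ?thesis
    unfolding family_basis_def img by (simp add: independent_unit_vec span_unit_vec)
qed

lemma module_mult: "module ((*) :: 'r::comm_ring_1 \<Rightarrow> 'r \<Rightarrow> 'r)"
  by standard (simp_all add: algebra_simps)

lemma monom_in_irrelevant_ideal:
  assumes "lk m v \<noteq> 0"
  shows "monom m \<in> generated_ideal (Set.range var)"
proof -
  interpret R: module "(*) :: ('a, 'b) mpoly \<Rightarrow> _" by (rule module_mult)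
  have "m = (m - Poly_Mapping.single v 1) + Poly_Mapping.single v 1"
    using assms by (intro poly_mapping_eqI) (auto simp: lookup_add lookup_minus lookup_single when_def)
  then have "monom m = monom (m - Poly_Mapping.single v 1) * var v"
    unfolding var_def by (metis monom_add)
  also have "\<dots> \<in> R.span (Set.range var)"
    by (intro R.span_scale R.span_base) auto
  finally show ?thesis by (simp add: generated_ideal_def)
qed

section \<open>The resolution of a bounded lattice of sets\<close>

text \<open>Passing from \<open>p\<close> to \<open>p - A\<close> trades x_i for y_i for each i in
  \<open>A\<close>; so for blocks of \<open>p\<close> the least common multiple of u_p and all these
  u_(p-A) is u_p times the y_i with i in the union of \<open>T\<close>.\<close>

definition cell_exp :: "'n::finite set \<times> 'n set set \<Rightarrow> ('n + 'n \<Rightarrow>\<^sub>0 nat)" where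
  "cell_exp = (\<lambda>(p, T). exp_x p + exp_y (- p) + exp_y (\<Union>T))"

definition cell_degree :: "'n::finite set \<times> 'n set set \<Rightarrow> ('n + 'n \<Rightarrow>\<^sub>0 int)" where
  "cell_degree k = multidegree (cell_exp k)"

lemma cell_exp_face_y:
  assumes "A \<in> T" "A \<inter> \<Union>(T - {A}) = {}"
  shows "cell_exp (p, T) = exp_y A + cell_exp (p, T - {A})"
proof -
  have "\<Union>T = A \<union> \<Union>(T - {A})" using assms(1) by blast
  then have "exp_y (\<Union>T) = exp_y A + exp_y (\<Union>(T - {A}))" by (metis exp_y_Un assms(2))
  then show ?thesis unfolding cell_exp_def prod.case by (simp only: ac_simps)
qed

text \<open>By \<open>exp_face\<close> both facets in direction \<open>A\<close> lead to the same
  total degree; this is the homogeneity of \<open>bd\<close>.\<close>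

lemma cell_exp_face_x:
  assumes "A \<in> T" "A \<inter> \<Union>(T - {A}) = {}" "A \<subseteq> p"
  shows "cell_exp (p, T) = exp_x A + cell_exp (p - A, T - {A})"
proof -
  have "cell_exp (p, T) = (exp_y A + (exp_x p + exp_y (- p))) + exp_y (\<Union>(T - {A}))"
    unfolding cell_exp_face_y[OF assms(1,2)] by (simp add: cell_exp_def add.assoc)
  then show ?thesis
    unfolding exp_face[OF assms(3)] by (simp add: cell_exp_def add.assoc)
qed

text \<open>All monomials are squarefree and can be compared variable by variable: the x-part is
  that of \<open>p\<close>, the largest set, and y_i occurs when some set misses i. As
  \<open>is_lcm\<close> tests arbitrary polynomials, divisibility is checked on each of their
  monomials.\<close>

lemma is_lcm_cell_exp:
  fixes p :: "'n::finite set"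
  assumes "\<And>q. q \<in> S \<Longrightarrow> q \<subseteq> p"
  shows "is_lcm (u ` insert p S) (monom (cell_exp (p, (\<lambda>q. p - q) ` S)) :: ('n + 'n, 'k::field) mpoly)"
proof -
  define e where "e = cell_exp (p, (\<lambda>q. p - q) ` S)"
  have e: "lk e (Inl i) = (if i \<in> p then 1 else 0)"
    "lk e (Inr i) = (if \<exists>q\<in>insert p S. i \<notin> q then 1 else 0)" for i
    using assms by (auto simp: e_def cell_exp_def lookup_add lookup_exp_x lookup_exp_y)
  have uq: "lk (exp_x q + exp_y (- q)) (Inl i) = (if i \<in> q then 1 else 0)"
    "lk (exp_x q + exp_y (- q)) (Inr i) = (if i \<in> q then 0 else 1)" for q :: "'n set" and i
    by (simp_all add: lookup_add lookup_exp_x lookup_exp_y)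
  have "u q dvd (monom e :: ('n + 'n, 'k) mpoly)" if "q \<in> insert p S" for q
  proof -
    have "q \<subseteq> p" using that assms by auto
    then have "lk (exp_x q + exp_y (- q)) v \<le> lk e v" for v
      using that by (cases v) (auto simp: e uq)
    then show ?thesis
      unfolding u_eq_monom by (subst monom_dvd_iff) (simp add: monom_def)
  qed
  moreover have "monom e dvd h" if "\<forall>q\<in>insert p S. u q dvd h" for h :: "('n + 'n, 'k) mpoly"
    unfolding monom_dvd_iff
  proof (intro ballI allI)
    fix k v assume k: "k \<in> Poly_Mapping.keys h"
    have le: "lk (exp_x q + exp_y (- q)) w \<le> lk k w" if "q \<in> insert p S" for q w
      using \<open>\<forall>q\<in>insert p S. u q dvd h\<close> that k unfolding u_eq_monom monom_dvd_iff by blast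
    show "lk e v \<le> lk k v"
    proof (cases v)
      case (Inl i)
      then show ?thesis using le[of p v] by (simp add: e uq)
    next
      case (Inr i)
      have "1 \<le> lk k v" if "q \<in> insert p S" "i \<notin> q" for q
        using le[of q v] that by (simp add: Inr uq)
      then show ?thesis by (auto simp: Inr e)
    qed
  qed
  ultimately show ?thesis unfolding is_lcm_def e_def by blast
qed

text \<open>With these bounds every cell of the lattice lies in \<open>cells {} UNIV\<close>, and
  \<open>acyclic\<close> applies to this interval.\<close>

locale bounded_set_lattice = set_lattice L for L :: "'n::finite set set" +
  assumes empty_mem: "{} \<in> L" and UNIV_mem: "UNIV \<in> L"
begin

definition cells_of_card :: "nat \<Rightarrow> ('n set \<times> 'n set set) set" where
  "cells_of_card i = {(p, T). p \<in> L \<and> T \<subseteq> blocks p \<and> card T = i}"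

lemma cells_of_card_eq: "cells_of_card i = cells {} UNIV \<inter> {k. card (snd k) = i}"
  by (auto simp: cells_of_card_def cells_def)

lemma face_cells_of_card:
  assumes "(p, T) \<in> cells_of_card (Suc i)" "A \<in> T"
  shows "(p, T - {A}) \<in> cells_of_card i" "(p - A, T - {A}) \<in> cells_of_card i"
  using assms cells_face[of p T "{}" UNIV A] by (auto simp: cells_of_card_eq)

lemma bd_unit_hcomp:
  assumes "k \<in> cells_of_card (Suc i)"
  shows "bd k \<in> hcomp (cells_of_card i) cell_degree (cell_degree k)"
proof -
  obtain p T where k: "k = (p, T)" by (cases k)
  \<comment> \<open>The summand \<open>0\<close> is the degree of the sign.\<close>
  have "fscale (sg A T) (face_diff A p (T - {A})) \<in>
      hcomp (cells_of_card i) cell_degree (0 + cell_degree (p, T))" if A: "A \<in> T" for A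
  proof (rule hcomp_scale[OF ring_comp_sg])
    have pT: "(p, T) \<in> cells {} UNIV" "A \<in> blocks p"
      using assms A by (auto simp: k cells_of_card_def cells_def)
    note disj = cells_disjoint[OF pT(1) A]
    note face = face_cells_of_card[OF assms[unfolded k] A]
    have y: "fscale (mon_y A) (unit_vec (p, T - {A})) \<in>
        hcomp (cells_of_card i) cell_degree (multidegree (exp_y A) + cell_degree (p, T - {A}))"
      by (intro hcomp_scale ring_comp_monom hcomp_unit_vec face)
    have x: "fscale (mon_x A) (unit_vec (p - A, T - {A})) \<in>
        hcomp (cells_of_card i) cell_degree (multidegree (exp_x A) + cell_degree (p - A, T - {A}))"
      by (intro hcomp_scale ring_comp_monom hcomp_unit_vec face)
    have deg: "cell_degree (p, T) = multidegree (exp_y A) + cell_degree (p, T - {A})"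
      "cell_degree (p, T) = multidegree (exp_x A) + cell_degree (p - A, T - {A})"
      unfolding cell_degree_def multidegree_add[symmetric]
      by (rule arg_cong[of _ _ multidegree], intro cell_exp_face_y A disj,
          rule arg_cong[of _ _ multidegree], intro cell_exp_face_x A disj blocksD(1)[OF pT(2)])
    show "face_diff A p (T - {A}) \<in> hcomp (cells_of_card i) cell_degree (cell_degree (p, T))"
      unfolding face_diff_def by (intro hcomp_diff y[folded deg(1)] x[folded deg(2)])
  qed
  then show ?thesis by (auto simp: k bd_def intro!: hcomp_sum)
qed

lemma bd_hcomp:
  "x \<in> hcomp (cells_of_card (Suc i)) cell_degree a \<Longrightarrow>
    lift bd x \<in> hcomp (cells_of_card i) cell_degree a"
  by (rule lift_hcomp[OF _ bd_unit_hcomp])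

lemma bd_supported_card:
  "x \<in> supported (cells_of_card (Suc i)) \<Longrightarrow> lift bd x \<in> supported (cells_of_card i)"
  by (rule lift_in_subspace[OF subspace_supported])
    (use bd_unit_hcomp in \<open>auto simp: hcomp_def\<close>)

lemma bd_supported_card_0:
  assumes "x \<in> supported (cells_of_card 0)"
  shows "lift bd x = 0"
proof -
  have "lift bd x = lift (\<lambda>k. 0) x"
    by (rule lift_cong[OF assms]) (auto simp: cells_of_card_def bd_def)
  then show ?thesis by (simp add: lift_def)
qed

lemma aug_supported_card_Suc:
  assumes "x \<in> supported (cells_of_card (Suc i))"
  shows "aug x = 0"
  unfolding aug_def
proof (rule sum.neutral, rule ballI)
  fix k :: "'n set \<times> 'n set set"
  show "lk x k * (if snd k = {} then u (fst k) else 0) = 0"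
    using assms by (cases k) (auto simp: supported_iff cells_of_card_def)
qed

lemma aug_hcomp:
  assumes "x \<in> hcomp (cells_of_card 0) cell_degree a"
  shows "aug x \<in> ring_comp a"
  unfolding aug_def
proof (rule ring_comp_sum)
  fix k :: "'n set \<times> 'n set set"
  show "lk x k * (if snd k = {} then u (fst k) else 0) \<in> ring_comp a"
  proof (cases "snd k = {}")
    case True
    then have "cell_exp k = exp_x (fst k) + exp_y (- fst k)"
      by (cases k) (simp add: cell_exp_def exp_y_def)
    then have "u (fst k) \<in> ring_comp (cell_degree k)"
      by (simp add: u_eq_monom cell_degree_def ring_comp_monom)
    moreover have "lk x k \<in> ring_comp (a - cell_degree k)"
      using assms by (simp add: hcomp_def del: split_paired_All)
    ultimately show ?thesis using ring_comp_mult True by fastforce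
  qed simp
qed

lemma aug_image:
  "aug ` supported (cells_of_card 0) = (generated_ideal (u ` L) :: ('n + 'n, 'k::field) mpoly set)"
proof -
  interpret R: module "(*) :: ('n + 'n, 'k) mpoly \<Rightarrow> _" by (rule module_mult)
  show ?thesis
    unfolding generated_ideal_def
  proof (intro antisym subsetI)
    fix f :: "('n + 'n, 'k) mpoly" assume "f \<in> aug ` supported (cells_of_card 0)"
    then obtain x where x: "x \<in> supported (cells_of_card 0)" "f = aug x" by auto
    have "lk x k * (if snd k = {} then u (fst k) else 0) \<in> R.span (u ` L)" for k
    proof (cases "k \<in> cells_of_card 0")
      case True
      then have "snd k = {}" "fst k \<in> L" by (auto simp: cells_of_card_def)
      then show ?thesis
        using R.span_scale[OF R.span_base[OF imageI[of "fst k" L u]]] by simp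
    next
      case False
      then show ?thesis
        using x(1) by (simp add: supported_iff R.span_zero del: split_paired_All)
    qed
    then show "f \<in> R.span (u ` L)"
      unfolding x(2) aug_def by (intro R.span_sum)
  next
    fix f :: "('n + 'n, 'k) mpoly" assume "f \<in> R.span (u ` L)"
    then show "f \<in> aug ` supported (cells_of_card 0)"
    proof (induction rule: R.span_induct_alt)
      case base
      then show ?case
        using aug_0 fmod.subspace_0[OF subspace_supported] by (metis imageI)
    next
      case (step c x y)
      then obtain p z where pz: "p \<in> L" "x = u p" "z \<in> supported (cells_of_card 0)" "y = aug z"
        by auto
      have "fscale c (unit_vec (p, {})) + z \<in> supported (cells_of_card 0)"
        using pz by (intro fmod.subspace_add fmod.subspace_scale subspace_supported)
          (auto simp: cells_of_card_def)
      moreover have "aug (fscale c (unit_vec (p, {})) + z) = c * x + y"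
        by (simp add: pz aug_add aug_scale)
      ultimately show ?case by (metis imageI)
    qed
  qed
qed

text \<open>The preimage given by \<open>acyclic\<close> may mix dimensions. Its components outside
  dimension \<open>Suc i\<close> have boundaries outside dimension \<open>i\<close>, where
  \<open>z\<close> lives, so dropping them leaves a preimage.\<close>

lemma exact_cells_of_card:
  fixes z :: "('n, 'k::field) cell_module"
  assumes "z \<in> supported (cells_of_card i)" "lift bd z = 0" "aug z = 0"
  shows "z \<in> lift bd ` supported (cells_of_card (Suc i))"
proof -
  have "z \<in> supported (cells {} UNIV)"
    using assms(1) by (rule supported_mono) (auto simp: cells_of_card_eq)
  then obtain w where w: "w \<in> supported (cells {} UNIV)" "lift bd w = z"
    using acyclic[OF empty_mem UNIV_mem] assms by blast
  define w' where "w' = restr (cells_of_card (Suc i)) w"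
  define w'' where "w'' = restr (- cells_of_card (Suc i)) w"
  have w': "w' \<in> supported (cells_of_card (Suc i))"
    unfolding w'_def by (rule restr_supported)
  have w'': "w'' \<in> supported (cells {} UNIV \<inter> {k. card (snd k) \<noteq> Suc i})"
    unfolding w''_def by (rule supported_mono[OF restr_supported_Int[OF w(1)]])
      (auto simp: cells_of_card_eq)
  have "lift bd w'' \<in> supported {k. card (snd k) \<noteq> i}"
    using w''
  proof (rule lift_in_subspace[OF subspace_supported])
    fix k assume "k \<in> cells {} UNIV \<inter> {k. card (snd k) \<noteq> Suc i}"
    then obtain p T where k: "k = (p, T)" "card T \<noteq> Suc i" by (cases k) auto
    have "card (T - {A}) \<noteq> i" if "A \<in> T" for A
      using k(2) that card_Suc_Diff1[of T A] by auto
    then show "bd k \<in> (supported {k. card (snd k) \<noteq> i} :: ('n, 'k) cell_module set)"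
      unfolding k bd_def face_diff_def
      by (auto intro!: fmod.subspace_sum fmod.subspace_scale fmod.subspace_diff subspace_supported)
  qed
  moreover have "lift bd w' - z \<in> supported (cells_of_card i)"
    using bd_supported_card[OF w'] assms(1) by (rule fmod.subspace_diff[OF subspace_supported])
  moreover have "w = w' + w''" unfolding w'_def w''_def by (rule restr_split)
  then have "z = lift bd w' + lift bd w''" using w(2) by (simp add: lift_add)
  then have "(lift bd w' - z) + lift bd w'' = 0" by simp
  moreover have "cells_of_card i \<inter> {k. card (snd k) \<noteq> i} = {}"
    by (auto simp: cells_of_card_eq)
  ultimately have "lift bd w' - z = 0"
    by (intro supported_disjoint_sum_eq_0(1)[of "lift bd w' - z" "lift bd w''"])
  then show ?thesis using w' by (intro image_eqI[of _ _ w']) auto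
qed

text \<open>Blocks are nonempty, so each coefficient x_A or y_A of the differential is divisible by
  a variable.\<close>

lemma bd_minimal:
  fixes x :: "('n, 'k::field) cell_module"
  assumes "x \<in> supported (cells_of_card (Suc i))"
  shows "lift bd x \<in> fmod.span {fscale r y | r y.
    r \<in> generated_ideal (Set.range var) \<and> y \<in> supported (cells_of_card i)}" (is "_ \<in> fmod.span ?G")
  using assms
proof (rule lift_in_subspace[OF fmod.subspace_span])
  fix k assume k: "k \<in> cells_of_card (Suc i)"
  obtain p T where pT: "k = (p, T)" by (cases k)
  have "face_diff A p (T - {A}) \<in> fmod.span ?G" if A: "A \<in> T" for A
  proof -
    have "A \<in> blocks p" using k A by (auto simp: pT cells_of_card_def)
    then obtain i where "i \<in> A" using blocksD(2) by blast
    then have "mon_x A \<in> (generated_ideal (Set.range var) :: ('n + 'n, 'k) mpoly set)"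
      "mon_y A \<in> (generated_ideal (Set.range var) :: ('n + 'n, 'k) mpoly set)"
      using monom_in_irrelevant_ideal[of "exp_x A" "Inl i"] monom_in_irrelevant_ideal[of "exp_y A" "Inr i"]
      by (auto simp: lookup_exp_x lookup_exp_y)
    moreover note face_cells_of_card[OF k[unfolded pT] A]
    ultimately show ?thesis
      unfolding face_diff_def by (intro fmod.span_diff fmod.span_base) (force simp: supported_def)+
  qed
  then show "bd k \<in> fmod.span ?G"
    by (auto simp: pT bd_def intro!: fmod.span_sum fmod.span_scale)
qed

lemma resolution:
  "minimal_multigraded_free_resolution
    (fscale :: ('n + 'n, 'k::field) mpoly \<Rightarrow> ('n, 'k) cell_module \<Rightarrow> _)
    (\<lambda>i. supported (cells_of_card i)) (\<lambda>i. hcomp (cells_of_card i) cell_degree)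
    (\<lambda>i. lift bd) aug (generated_ideal (u ` L))"
proof (intro minimal_multigraded_free_resolution.intro
    minimal_multigraded_free_resolution_axioms.intro fmod.module_axioms)
  fix i and a :: "'n + 'n \<Rightarrow>\<^sub>0 int"
  let ?F = "\<lambda>i. supported (cells_of_card i) :: ('n, 'k) cell_module set"
  show "multigraded_module fscale (?F i) (hcomp (cells_of_card i) cell_degree)"
    by (rule hcomp_multigraded_module)
  have "unit_vec ` cells_of_card i \<subseteq> (\<Union>a. hcomp (cells_of_card i) cell_degree a :: ('n, 'k) cell_module set)"
    using hcomp_unit_vec by fastforce
  moreover have "family_basis fscale (?F i) (unit_vec ` cells_of_card i) (\<lambda>x. x)"
    by (simp add: family_basis_def independent_unit_vec span_unit_vec)
  ultimately show "\<exists>B\<subseteq>\<Union>a. hcomp (cells_of_card i) cell_degree a. family_basis fscale (?F i) B (\<lambda>x. x)"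
    by blast
  show "linear_map_on fscale fscale (?F (Suc i)) (lift bd)"
    by (simp add: linear_map_on_def lift_add lift_scale)
  show "lift bd ` hcomp (cells_of_card (Suc i)) cell_degree a \<subseteq>
      (hcomp (cells_of_card i) cell_degree a :: ('n, 'k) cell_module set)"
    by (auto intro: bd_hcomp)
  show "linear_map_on fscale (*) (?F 0) aug"
    by (simp add: linear_map_on_def aug_add aug_scale)
  show "aug ` hcomp (cells_of_card 0) cell_degree a \<subseteq> (ring_comp a :: ('n + 'n, 'k) mpoly set)"
    by (auto intro: aug_hcomp)
  show "aug ` ?F 0 = generated_ideal (u ` L)"
    by (rule aug_image)
  show "lift bd ` ?F 1 = {x \<in> ?F 0. aug x = 0}"
  proof (intro antisym subsetI)
    fix z assume "z \<in> lift bd ` ?F 1"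
    then obtain x where x: "x \<in> ?F (Suc 0)" "z = lift bd x" by auto
    then have "x \<in> supported (cells {} UNIV)"
      by (auto simp: cells_of_card_eq elim: supported_mono)
    then show "z \<in> {x \<in> ?F 0. aug x = 0}"
      using x bd_supported_card aug_bd_cells by auto
  next
    fix z assume "z \<in> {x \<in> ?F 0. aug x = 0}"
    \<comment> \<open>In dimension 0 the cycle condition is automatic, since the sum defining
      \<open>bd\<close> is empty.\<close>
    then show "z \<in> lift bd ` ?F 1"
      using exact_cells_of_card[of z 0] bd_supported_card_0[of z] by simp
  qed
  show "lift bd ` ?F (Suc (Suc i)) = {x \<in> ?F (Suc i). lift bd x = 0}"
  proof (intro antisym subsetI)
    fix z assume "z \<in> lift bd ` ?F (Suc (Suc i))"
    then show "z \<in> {x \<in> ?F (Suc i). lift bd x = 0}"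
      using bd_supported_card by (auto simp: bd_bd)
  next
    fix z assume "z \<in> {x \<in> ?F (Suc i). lift bd x = 0}"
    then have z: "z \<in> ?F (Suc i)" "lift bd z = 0" by auto
    \<comment> \<open>In positive dimension it is the vanishing of \<open>aug\<close> that is
      automatic.\<close>
    then show "z \<in> lift bd ` ?F (Suc (Suc i))"
      by (rule exact_cells_of_card[OF _ _ aug_supported_card_Suc[OF z(1)]])
  qed
  show "lift bd ` ?F (Suc i) \<subseteq> fmod.span {fscale r x | r x.
      r \<in> generated_ideal (Set.range var) \<and> x \<in> ?F i}"
    by (rule image_subsetI, rule bd_minimal)
qed

lemma lower_neighbors_inj: "inj_on (\<lambda>q. p - q) (lower_neighbors L p)"
  by (rule inj_onI) (auto simp: lower_neighbors_def)

text \<open>Translates between the index pairs of the statement, with sets of lower neighbours, and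
  those of the construction, with sets of blocks; taking complements inside \<open>p\<close> is
  injective on subsets of \<open>p\<close>.\<close>

lemma index_cells_of_card:
  defines "I \<equiv> \<lambda>i. {(p, S). p \<in> L \<and> S \<subseteq> lower_neighbors L p \<and> card S = i}"
    and "h \<equiv> \<lambda>(p, S). (p, (\<lambda>q. p - q) ` S)"
  shows "inj_on h (I i)" "h ` I i = cells_of_card i"
proof -
  have card: "card ((\<lambda>q. p - q) ` S) = card S" if "S \<subseteq> lower_neighbors L p" for p S
    using that lower_neighbors_inj by (meson card_image inj_on_subset)
  show "inj_on h (I i)"
  proof (rule inj_onI)
    fix k k' assume k: "k \<in> I i" "k' \<in> I i" "h k = h k'"
    obtain p S where pS: "k = (p, S)" by (cases k)
    obtain p' S' where pS': "k' = (p', S')" by (cases k')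
    have eq: "p = p'" "(\<lambda>q. p - q) ` S = (\<lambda>q. p' - q) ` S'"
      using k(3) by (auto simp: h_def pS pS')
    have "S \<subseteq> lower_neighbors L p" "S' \<subseteq> lower_neighbors L p"
      using k(1,2) by (simp_all add: I_def pS pS' eq(1))
    with eq have "S = S'" using inj_on_image_eq_iff[OF lower_neighbors_inj, of S p S'] by simp
    then show "k = k'" by (simp add: pS pS' eq(1))
  qed
  show "h ` I i = cells_of_card i"
  proof
    show "h ` I i \<subseteq> cells_of_card i"
      by (auto simp: h_def I_def cells_of_card_def blocks_def card)
    show "cells_of_card i \<subseteq> h ` I i"
    proof clarify
      fix p T assume "(p, T) \<in> cells_of_card i"
      then have T: "p \<in> L" "T \<subseteq> (\<lambda>q. p - q) ` lower_neighbors L p" "card T = i"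
        by (auto simp: cells_of_card_def blocks_def)
      then obtain S where S: "S \<subseteq> lower_neighbors L p" "T = (\<lambda>q. p - q) ` S"
        by (meson subset_imageE)
      then have "(p, S) \<in> I i" using T card by (simp add: I_def)
      then show "(p, T) \<in> h ` I i" by (rule rev_image_eqI) (simp add: h_def S)
    qed
  qed
qed

end

section \<open>The lattice of vertex covers\<close>

text \<open>Any cover needs an endpoint of each matching edge. This one has exactly one of them, so
  nothing can be deleted.\<close>

lemma minimal_cover_of_matching:
  fixes E :: "('n::finite + 'n) set set"
  assumes "\<And>i. {Inl i, Inr i} \<in> E" "vertex_cover UNIV E (Inl ` p \<union> Inr ` (- p))"
  shows "minimal_vertex_cover UNIV E (Inl ` p \<union> Inr ` (- p))"
  unfolding minimal_vertex_cover_def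
proof (intro conjI allI impI notI)
  fix D :: "('n + 'n) set"
  assume D: "D \<subset> Inl ` p \<union> Inr ` (- p)" "vertex_cover UNIV E D"
  have hit: "Inl i \<in> D \<or> Inr i \<in> D" for i
  proof -
    have "{Inl i, Inr i} \<inter> D \<noteq> {}" using D(2) assms(1)[of i] unfolding vertex_cover_def by blast
    then show ?thesis by simp
  qed
  have "Inl ` p \<union> Inr ` (- p) \<subseteq> D"
  proof
    fix v assume "v \<in> Inl ` p \<union> Inr ` (- p)"
    then show "v \<in> D"
    proof (cases v)
      case (Inl i)
      then show ?thesis using \<open>v \<in> _\<close> hit[of i] D(1) by auto
    next
      case (Inr i)
      then show ?thesis using \<open>v \<in> _\<close> hit[of i] D(1) by auto
    qed
  qed
  then show False using D(1) by blast
qed (fact assms(2))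

text \<open>The lattice consists of the sets closed under the relation "j in p implies i in p", one
  implication for each edge joining x_i and y_j. In this form closure under union and intersection
  and the two bounds are immediate.\<close>

lemma cover_lattice_iff:
  fixes E :: "('n::finite + 'n) set set"
  assumes bipartite: "bipartite_graph (Set.range Inl) (Set.range Inr) E"
    and unmixed: "unmixed UNIV E"
    and matching: "\<And>i. {Inl i, Inr i} \<in> E"
  shows "p \<in> cover_lattice E \<longleftrightarrow> (\<forall>i j. {Inl i, Inr j} \<in> E \<longrightarrow> i \<in> p \<or> j \<notin> p)"
proof -
  have edge: "\<exists>i j. e = {Inl i, Inr j}" if "e \<in> E" for e
    using bipartite that by (auto simp: bipartite_graph_def)
  have cover: "vertex_cover UNIV E (Inl ` p \<union> Inr ` (- p))"
    if "\<forall>i j. {Inl i, Inr j} \<in> E \<longrightarrow> i \<in> p \<or> j \<notin> p" for p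
    unfolding vertex_cover_def
  proof (intro conjI ballI subset_UNIV)
    fix e assume "e \<in> E"
    then obtain i j where e: "e = {Inl i, Inr j}" using edge by blast
    then have "i \<in> p \<or> j \<notin> p" using that \<open>e \<in> E\<close> by blast
    then show "e \<inter> (Inl ` p \<union> Inr ` (- p)) \<noteq> {}" by (auto simp: e)
  qed
  have vim: "Inl -` (Inl ` p \<union> Inr ` (- p)) = p" for p :: "'n set" by auto
  show ?thesis
  proof
    assume "p \<in> cover_lattice E"
    then obtain C where C: "minimal_vertex_cover UNIV E C" "p = Inl -` C"
      by (auto simp: cover_lattice_def)
    define q where "q = Inr -` C"
    \<comment> \<open>The set of all x_i is a minimal cover, so by unmixedness every minimal cover
      has as many elements as there are matching edges, and thus only one endpoint of each.\<close>
    have "minimal_vertex_cover UNIV E (Inl ` UNIV \<union> Inr ` (- UNIV))"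
      by (intro minimal_cover_of_matching matching cover) auto
    then have "card C = card (Inl ` UNIV \<union> Inr ` (- UNIV) :: ('n + 'n) set)"
      using unmixed C(1) unfolding unmixed_def by blast
    then have card_C: "card C = card (UNIV :: 'n set)" by (simp add: card_image)
    have C_eq: "C = Inl ` p \<union> Inr ` q"
    proof (rule set_eqI)
      fix v show "v \<in> C \<longleftrightarrow> v \<in> Inl ` p \<union> Inr ` q" by (cases v) (auto simp: C(2) q_def)
    qed
    have "card C = card (Inl ` p :: ('n + 'n) set) + card (Inr ` q :: ('n + 'n) set)"
      unfolding C_eq by (rule card_Un_disjoint) auto
    then have "card p + card q = card (UNIV :: 'n set)"
      using card_C by (simp add: card_image)
    moreover have "p \<union> q = UNIV"
    proof -
      have "{Inl i, Inr i} \<inter> C \<noteq> {}" for i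
        using C(1) matching[of i] unfolding minimal_vertex_cover_def vertex_cover_def by blast
      then show ?thesis by (auto simp: C(2) q_def)
    qed
    ultimately have "card (p \<inter> q) = 0"
      using card_Un_Int[of p q] by simp
    then have "p \<inter> q = {}" by simp
    show "\<forall>i j. {Inl i, Inr j} \<in> E \<longrightarrow> i \<in> p \<or> j \<notin> p"
    proof (intro allI impI)
      fix i j assume "{Inl i, Inr j} \<in> E"
      then have "{Inl i, Inr j} \<inter> C \<noteq> {}"
        using C(1) unfolding minimal_vertex_cover_def vertex_cover_def by blast
      then show "i \<in> p \<or> j \<notin> p" using \<open>p \<inter> q = {}\<close> by (auto simp: C(2) q_def)
    qed
  next
    assume "\<forall>i j. {Inl i, Inr j} \<in> E \<longrightarrow> i \<in> p \<or> j \<notin> p"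
    then have "minimal_vertex_cover UNIV E (Inl ` p \<union> Inr ` (- p))"
      by (intro minimal_cover_of_matching matching cover)
    then show "p \<in> cover_lattice E"
      unfolding cover_lattice_def using vim[of p] by blast
  qed
qed

theorem theorem1p2:
  fixes E :: "('n::finite + 'n) set set"
  assumes bipartite: "bipartite_graph (range Inl) (range Inr) E"
    and no_isolated: "no_isolated_vertices UNIV E"
    and unmixed: "unmixed UNIV E"
    and matching: "\<And>i. {Inl i, Inr i} \<in> E"
  shows "\<exists>(scale :: ('n + 'n, 'k::field) mpoly \<Rightarrow>
             (('n set \<times> 'n set set) \<Rightarrow>\<^sub>0 ('n + 'n, 'k) mpoly) \<Rightarrow>
             (('n set \<times> 'n set set) \<Rightarrow>\<^sub>0 ('n + 'n, 'k) mpoly)) F comp d eps.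
    minimal_multigraded_free_resolution scale F comp d eps (H E) \<and>
    (\<forall>i. \<exists>b.
       family_basis scale (F i)
         {(p, S). p \<in> cover_lattice E \<and> S \<subseteq> lower_neighbors (cover_lattice E) p \<and> card S = i} b \<and>
       (\<forall>p\<in>cover_lattice E. \<forall>S \<subseteq> lower_neighbors (cover_lattice E) p. card S = i \<longrightarrow>
          (\<exists>m. is_lcm (u ` insert p S) (monom m :: ('n + 'n, 'k) mpoly) \<and>
               b (p, S) \<in> comp i (multidegree m))))"
proof -
  interpret bounded_set_lattice "cover_lattice E"
    by standard (auto simp: cover_lattice_iff[OF bipartite unmixed matching])
  let ?h = "\<lambda>(p, S). (p, (\<lambda>q. p - q) ` S)"
  let ?b = "\<lambda>k. unit_vec (?h k) :: ('n, 'k) cell_module"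
  let ?I = "\<lambda>i. {(p, S). p \<in> cover_lattice E \<and> S \<subseteq> lower_neighbors (cover_lattice E) p \<and> card S = i}"
  have basis: "family_basis fscale (supported (cells_of_card i)) (?I i) ?b" for i
    using index_cells_of_card by (rule family_basis_unit_vec)
  have degree: "\<exists>m. is_lcm (u ` insert p S) (monom m :: ('n + 'n, 'k) mpoly) \<and>
      ?b (p, S) \<in> hcomp (cells_of_card i) cell_degree (multidegree m)"
    if "p \<in> cover_lattice E" "S \<subseteq> lower_neighbors (cover_lattice E) p" "card S = i" for p S i
  proof (intro exI conjI)
    \<comment> \<open>The exponent \<open>m\<close> is that of the cell obtained by replacing the
      lower neighbours in \<open>S\<close> by their blocks.\<close>
    show "is_lcm (u ` insert p S) (monom (cell_exp (?h (p, S))) :: ('n + 'n, 'k) mpoly)"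
      using is_lcm_cell_exp[of S p] that(2) by (auto simp: lower_neighbors_def)
    have "?h (p, S) \<in> cells_of_card i"
      using that index_cells_of_card(2)[of i] by blast
    from hcomp_unit_vec[OF this, of cell_degree]
    show "?b (p, S) \<in> hcomp (cells_of_card i) cell_degree (multidegree (cell_exp (?h (p, S))))"
      by (simp add: cell_degree_def)
  qed
  show ?thesis
    unfolding H_def
  proof (rule exI[of _ fscale], rule exI[of _ "\<lambda>i. supported (cells_of_card i)"],
      rule exI[of _ "\<lambda>i. hcomp (cells_of_card i) cell_degree"], rule exI[of _ "\<lambda>i. lift bd"],
      rule exI[of _ aug], intro conjI allI resolution)
    fix i
    show "\<exists>b. family_basis fscale (supported (cells_of_card i) :: ('n, 'k) cell_module set) (?I i) b \<and>
       (\<forall>p\<in>cover_lattice E. \<forall>S \<subseteq> lower_neighbors (cover_lattice E) p. card S = i \<longrightarrow>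
          (\<exists>m. is_lcm (u ` insert p S) (monom m :: ('n + 'n, 'k) mpoly) \<and>
               b (p, S) \<in> hcomp (cells_of_card i) cell_degree (multidegree m)))"
      by (rule exI[of _ ?b], intro conjI basis ballI allI impI degree)
  qed
qed

end
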